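(* Let $\mathcal{W}$ be the Lie algebra $W(2,2)$, and let $M$ be a $U(\mathcal{W})$-module whose restriction to $U(\mathbb{C}L_0\oplus\mathbb{C}W_0)$ is free of rank $1$. Then $M\cong\Omega(\lambda,\alpha,\mathbf{h})$ as $\mathcal{W}$-modules for some $\alpha\in\mathbb{C}$, $\lambda\in\mathbb{C}^*$ and $\mathbf{h}=\{h_n(t)\}_{n\in\mathbb{Z}}\in\mathcal{H}_\alpha$.
   Context: $\mathbb{C}^*=\mathbb{C}\setminus\{0\}$, and $U(\cdot)$ denotes the universal enveloping algebra. The Lie algebra $\mathcal{W}=W(2,2)$ is the complex Lie algebra with basis $\{L_n, W_n, C_1, C_2\mid n\in\mathbb{Z}\}$ and brackets, for all $m,n\in\mathbb{Z}$, $$[L_m,L_n]=(n-m)L_{m+n}+\delta_{m+n,0}\frac{m^3-m}{12}C_1,$$ $$[L_m,W_n]=(n-m)W_{m+n}+\delta_{m+n,0}\frac{m^3-m}{12}C_2,$$ $$[W_m,W_n]=0,$$ where $C_1,C_2$ are central. For $\alpha\in\mathbb{C}$, an integer $k\geq 0$ and $n\in\mathbb{Z}$, define the polynomial $$h_{n,k;\alpha}(t)=nt^k-n(n-1)\alpha\,\frac{t^k-\alpha^k}{t-\alpha}\in\mathbb{C}[t]$$ (the quotient is the polynomial $\sum_{j=0}^{k-1}t^{j}\alpha^{k-1-j}$, which is $0$ for $k=0$, so $h_{n,0;\alpha}(t)=n$). Let $\mathcal{H}_\alpha$ be the set of families of polynomials $\{h_n(t)\}_{n\in\mathbb{Z}}$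 of the form $h_n(t)=\sum_{i=0}^{\infty}\xi_i h_{n,i;\alpha}(t)\in\mathbb{C}[t]$ for all $n\in\mathbb{Z}$, where the coefficients $\xi_i\in\mathbb{C}$ are independent of $n$ and only finitely many of them are nonzero. In particular $\mathcal{H}_0=\{\{nh(t)\}_{n\in\mathbb{Z}}\mid h(t)\in\mathbb{C}[t]\}$. For $\lambda\in\mathbb{C}^*$, $\alpha\in\mathbb{C}$ and $\mathbf{h}=\{h_n(t)\}_{n\in\mathbb{Z}}\in\mathcal{H}_\alpha$, $\Omega(\lambda,\alpha,\mathbf{h})$ is the $\mathcal{W}$-module with underlying space the polynomial algebra $\mathbb{C}[t,s]$ and action, for $f(t,s)\in\mathbb{C}[t,s]$ and $m\in\mathbb{Z}$, $$C_1\big(f(t,s)\big)=C_2\big(f(t,s)\big)=0,\qquad W_m\big(f(t,s)\big)=\lambda^m(t-m\alpha)f(t,s-m),$$ $$L_m\big(f(t,s)\big)=\lambda^m\big(s+h_m(t)\big)f(t,s-m)-m\lambda^m(t-m\alpha)\frac{\partial}{\partial t}\big(f(t,s-m)\big).$$ *)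

theory Defs
  imports Complex_Main "HOL-Library.Poly_Mapping" "HOL-Computational_Algebra.Polynomial"
begin

class complex_lie_algebra = ab_group_add +
  fixes scaleL :: "complex \<Rightarrow> 'a \<Rightarrow> 'a" (infixr \<open>*\<^sub>C\<close> 75)
    and bracket :: "'a \<Rightarrow> 'a \<Rightarrow> 'a"
  assumes scaleL_add_right: "c *\<^sub>C (x + y) = c *\<^sub>C x + c *\<^sub>C y"
    and scaleL_add_left: "(c + d) *\<^sub>C x = c *\<^sub>C x + d *\<^sub>C x"
    and scaleL_scaleL: "c *\<^sub>C d *\<^sub>C x = (c * d) *\<^sub>C x"
    and scaleL_one: "1 *\<^sub>C x = x"
    and bracket_add_left: "bracket (x + y) z = bracket x z + bracket y z"
    and bracket_add_right: "bracket x (y + z) = bracket x y + bracket x z"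
    and bracket_scaleL_left: "bracket (c *\<^sub>C x) y = c *\<^sub>C bracket x y"
    and bracket_scaleL_right: "bracket x (c *\<^sub>C y) = c *\<^sub>C bracket x y"
    and bracket_self: "bracket x x = 0"
    and jacobi: "bracket x (bracket y z) + bracket y (bracket z x) + bracket z (bracket x y) = 0"

definition lie_hom :: "('g::complex_lie_algebra \<Rightarrow> 'h::complex_lie_algebra) \<Rightarrow> bool" where
  "lie_hom f \<longleftrightarrow> (\<forall>x y. f (x + y) = f x + f y) \<and> (\<forall>c x. f (c *\<^sub>C x) = c *\<^sub>C f x) \<and>
     (\<forall>x y. f (bracket x y) = bracket (f x) (f y))"

locale lie_module = vector_space scale
  for scale :: "complex \<Rightarrow> 'v::ab_group_add \<Rightarrow> 'v" +
  fixes rep :: "'g::complex_lie_algebra \<Rightarrow> 'v \<Rightarrow> 'v"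
  assumes rep_linear: "Vector_Spaces.linear scale scale (rep x)"
    and rep_add: "rep (x + y) v = rep x v + rep y v"
    and rep_scaleL: "rep (c *\<^sub>C x) v = scale c (rep x v)"
    and rep_bracket: "rep (bracket x y) v = rep x (rep y v) - rep y (rep x v)"

definition lie_module_isomorphic ::
  "(complex \<Rightarrow> 'v::ab_group_add \<Rightarrow> 'v) \<Rightarrow> ('g::complex_lie_algebra \<Rightarrow> 'v \<Rightarrow> 'v) \<Rightarrow>
   (complex \<Rightarrow> 'w::ab_group_add \<Rightarrow> 'w) \<Rightarrow> ('g \<Rightarrow> 'w \<Rightarrow> 'w) \<Rightarrow> bool" where
  "lie_module_isomorphic scale1 rep1 scale2 rep2 \<longleftrightarrow>
     lie_module scale1 rep1 \<and> lie_module scale2 rep2 \<and>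
     (\<exists>\<phi>. Vector_Spaces.linear scale1 scale2 \<phi> \<and> bij \<phi> \<and> (\<forall>x v. \<phi> (rep1 x v) = rep2 x (\<phi> v)))"

definition pm_scale :: "complex \<Rightarrow> ('a \<Rightarrow>\<^sub>0 complex) \<Rightarrow> ('a \<Rightarrow>\<^sub>0 complex)" where
  "pm_scale c = Poly_Mapping.map ((*) c)"

definition lin_ext ::
  "(complex \<Rightarrow> 'v::ab_group_add \<Rightarrow> 'v) \<Rightarrow> ('b \<Rightarrow> 'v) \<Rightarrow> ('b \<Rightarrow>\<^sub>0 complex) \<Rightarrow> 'v" where
  "lin_ext scale f p = (\<Sum>b\<in>Poly_Mapping.keys p. scale (Poly_Mapping.lookup p b) (f b))"

lemma lookup_pm_scale [simp]:
  "Poly_Mapping.lookup (pm_scale c p) k = c * Poly_Mapping.lookup p k"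
  by (auto simp: pm_scale_def Poly_Mapping.map.rep_eq when_def)

lemma pm_scale_vector_space: "vector_space pm_scale"
  by unfold_locales (auto intro!: poly_mapping_eqI simp: lookup_add algebra_simps)

interpretation pm: vector_space pm_scale
  by (rule pm_scale_vector_space)

lemma lin_ext_superset:
  assumes "vector_space scale" "finite A" "Poly_Mapping.keys p \<subseteq> A"
  shows "lin_ext scale f p = (\<Sum>b\<in>A. scale (Poly_Mapping.lookup p b) (f b))"
proof -
  interpret vector_space scale by fact
  show ?thesis unfolding lin_ext_def
    by (rule sum.mono_neutral_left) (use assms in \<open>auto simp: in_keys_iff\<close>)
qed

lemma lin_ext_add:
  assumes "vector_space scale"
  shows "lin_ext scale f (p + q) = lin_ext scale f p + lin_ext scale f q"
proof -
  interpret vector_space scale by fact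
  let ?A = "Poly_Mapping.keys p \<union> Poly_Mapping.keys q"
  have "lin_ext scale f r = (\<Sum>b\<in>?A. scale (Poly_Mapping.lookup r b) (f b))"
    if "Poly_Mapping.keys r \<subseteq> ?A" for r
    using lin_ext_superset[OF assms _ that] by simp
  from this[of p] this[of q] this[of "p + q"] show ?thesis
    using Poly_Mapping.keys_add[of p q] by (simp add: lookup_add scale_left_distrib sum.distrib)
qed

lemma lin_ext_scale:
  assumes "vector_space scale"
  shows "lin_ext scale f (pm_scale c p) = scale c (lin_ext scale f p)"
proof -
  interpret vector_space scale by fact
  have "Poly_Mapping.keys (pm_scale c p) \<subseteq> Poly_Mapping.keys p"
    by (auto simp: in_keys_iff)
  from lin_ext_superset[OF assms _ this, of f] show ?thesis
    by (simp add: lin_ext_def scale_sum_right)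
qed

lemma lin_ext_single [simp]:
  assumes "vector_space scale"
  shows "lin_ext scale f (Poly_Mapping.single b c) = scale c (f b)"
proof -
  interpret vector_space scale by fact
  show ?thesis by (auto simp: lin_ext_def)
qed

lemma lin_ext_fun_add:
  assumes "vector_space scale"
  shows "lin_ext scale (\<lambda>b. f b + g b) p = lin_ext scale f p + lin_ext scale g p"
proof -
  interpret vector_space scale by fact
  show ?thesis by (simp add: lin_ext_def scale_right_distrib sum.distrib)
qed

lemma lin_ext_fun_scale:
  assumes "vector_space scale"
  shows "lin_ext scale (\<lambda>b. scale c (f b)) p = scale c (lin_ext scale f p)"
proof -
  interpret vector_space scale by fact
  show ?thesis by (simp add: lin_ext_def scale_sum_right mult.commute)
qed

lemma pm_induct [case_names add scale single]:
  fixes p :: "'a \<Rightarrow>\<^sub>0 complex"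
  assumes add: "\<And>p q. P p \<Longrightarrow> P q \<Longrightarrow> P (p + q)"
    and scale: "\<And>c p. P p \<Longrightarrow> P (pm_scale c p)"
    and single: "\<And>b. P (Poly_Mapping.single b 1)"
  shows "P p"
proof -
  have 0: "P 0" using scale[OF single, of 0] by simp
  have "P (\<Sum>b\<in>A. pm_scale (Poly_Mapping.lookup p b) (Poly_Mapping.single b 1))" if "finite A" for A
    using that by (induction A rule: finite_induct) (auto intro: 0 add scale single)
  moreover have "(\<Sum>b\<in>Poly_Mapping.keys p. pm_scale (Poly_Mapping.lookup p b) (Poly_Mapping.single b 1)) = p"
  proof (rule poly_mapping_eqI)
    fix k
    have "(\<Sum>b\<in>Poly_Mapping.keys p. Poly_Mapping.lookup p b * (if b = k then 1 else 0)) =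
        (\<Sum>b\<in>Poly_Mapping.keys p. if b = k then Poly_Mapping.lookup p b else 0)"
      by (rule sum.cong) auto
    then show "Poly_Mapping.lookup (\<Sum>b\<in>Poly_Mapping.keys p.
        pm_scale (Poly_Mapping.lookup p b) (Poly_Mapping.single b 1)) k = Poly_Mapping.lookup p k"
      by (simp add: lookup_sum lookup_single when_def sum.delta in_keys_iff)
  qed
  ultimately show ?thesis by (metis finite_keys)
qed

datatype w22_basis = BL int | BW int | BC1 | BC2

definition w22_cocycle :: "int \<Rightarrow> int \<Rightarrow> complex" where
  "w22_cocycle m n = (if m + n = 0 then of_int (m ^ 3 - m) / 12 else 0)"

fun w22_basis_bracket :: "w22_basis \<Rightarrow> w22_basis \<Rightarrow> (w22_basis \<Rightarrow>\<^sub>0 complex)" where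
  "w22_basis_bracket (BL m) (BL n) =
     Poly_Mapping.single (BL (m + n)) (of_int (n - m)) + Poly_Mapping.single BC1 (w22_cocycle m n)"
| "w22_basis_bracket (BL m) (BW n) =
     Poly_Mapping.single (BW (m + n)) (of_int (n - m)) + Poly_Mapping.single BC2 (w22_cocycle m n)"
| "w22_basis_bracket (BW m) (BL n) =
     - (Poly_Mapping.single (BW (n + m)) (of_int (m - n)) + Poly_Mapping.single BC2 (w22_cocycle n m))"
| "w22_basis_bracket _ _ = 0"

definition w22_bracket ::
  "(w22_basis \<Rightarrow>\<^sub>0 complex) \<Rightarrow> (w22_basis \<Rightarrow>\<^sub>0 complex) \<Rightarrow> (w22_basis \<Rightarrow>\<^sub>0 complex)" where
  "w22_bracket x y = lin_ext pm_scale (\<lambda>a. lin_ext pm_scale (w22_basis_bracket a) y) x"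

lemma w22_bracket_add_left: "w22_bracket (x + y) z = w22_bracket x z + w22_bracket y z"
  by (simp add: w22_bracket_def lin_ext_add pm_scale_vector_space)

lemma w22_bracket_add_right: "w22_bracket x (y + z) = w22_bracket x y + w22_bracket x z"
  by (simp add: w22_bracket_def lin_ext_add lin_ext_fun_add pm_scale_vector_space)

lemma w22_bracket_scale_left: "w22_bracket (pm_scale c x) y = pm_scale c (w22_bracket x y)"
  by (simp add: w22_bracket_def lin_ext_scale pm_scale_vector_space)

lemma w22_bracket_scale_right: "w22_bracket x (pm_scale c y) = pm_scale c (w22_bracket x y)"
  by (simp add: w22_bracket_def lin_ext_scale[OF pm_scale_vector_space]
      lin_ext_fun_scale[OF pm_scale_vector_space, of c "\<lambda>a. lin_ext pm_scale (w22_basis_bracket a) y"])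

lemmas w22_bracket_linear = w22_bracket_add_left w22_bracket_add_right
  w22_bracket_scale_left w22_bracket_scale_right

lemma w22_bracket_single:
  "w22_bracket (Poly_Mapping.single a c) (Poly_Mapping.single b d) =
     pm_scale (c * d) (w22_basis_bracket a b)"
  by (simp add: w22_bracket_def pm_scale_vector_space)

lemma w22_bracket_zero: "w22_bracket 0 y = 0" "w22_bracket x 0 = 0"
  using w22_bracket_scale_left[of 0] w22_bracket_scale_right[of _ 0] by simp_all

lemma w22_bracket_minus: "w22_bracket (- x) y = - w22_bracket x y" "w22_bracket x (- y) = - w22_bracket x y"
  using w22_bracket_scale_left[of "-1"] w22_bracket_scale_right[of _ "-1"] by simp_all

lemma w22_bracket_diff: "w22_bracket x (y - z) = w22_bracket x y - w22_bracket x z"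
  using w22_bracket_add_right[of x y "- z"] by (simp add: w22_bracket_minus)

lemma w22_cocycle_antisym: "w22_cocycle n m = - w22_cocycle m n"
proof (cases "m + n = 0")
  case True
  then have "n = - m" by simp
  then show ?thesis by (simp add: w22_cocycle_def field_simps)
qed (simp add: w22_cocycle_def add.commute)

lemma w22_basis_bracket_antisym: "w22_basis_bracket a b = - w22_basis_bracket b a"
proof (cases a; cases b)
  fix m n
  assume ab: "a = BL m" "b = BL n"
  have "Poly_Mapping.single (BL (n + m)) (of_int (m - n)) = - Poly_Mapping.single (BL (m + n)) (of_int (n - m) :: complex)"
    by (simp add: add.commute flip: single_uminus)
  then show ?thesis
    by (simp only: ab w22_basis_bracket.simps w22_cocycle_antisym[of n m] single_uminus) simp
qed simp_all

lemma w22_bracket_antisym: "w22_bracket x y = - w22_bracket y x"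
proof (induction x rule: pm_induct)
  case (single a)
  show ?case
  proof (induction y rule: pm_induct)
    case (single b)
    show ?case
      by (subst (2) w22_bracket_single)
        (simp add: w22_bracket_single w22_basis_bracket_antisym[of a b])
  qed (simp_all add: w22_bracket_linear pm.scale_minus_right)
qed (simp_all add: w22_bracket_linear pm.scale_minus_right)

lemma w22_bracket_self: "w22_bracket x x = 0"
proof (rule poly_mapping_eqI)
  fix k
  have "Poly_Mapping.lookup (w22_bracket x x) k = - Poly_Mapping.lookup (w22_bracket x x) k"
    by (metis w22_bracket_antisym lookup_uminus)
  then show "Poly_Mapping.lookup (w22_bracket x x) k = Poly_Mapping.lookup 0 k"
    by simp
qed

lemma w22_cocycle_identity:
  "of_int (l - n) * w22_cocycle m (n + l) + of_int (m - l) * w22_cocycle n (l + m)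
     + of_int (n - m) * w22_cocycle l (m + n) = 0"
proof (cases "m + n + l = 0")
  case True
  then have l: "l = - m - n" by simp
  have "(l - n) * (m ^ 3 - m) + (m - l) * (n ^ 3 - n) + (n - m) * (l ^ 3 - l) = 0"
    unfolding l by (simp add: power3_eq_cube algebra_simps)
  then have "of_int ((l - n) * (m ^ 3 - m) + (m - l) * (n ^ 3 - n) + (n - m) * (l ^ 3 - l)) / 12 = (0 :: complex)"
    by simp
  moreover have "m + (n + l) = 0" "n + (l + m) = 0" "l + (m + n) = 0"
    using True by simp_all
  ultimately show ?thesis
    by (simp only: w22_cocycle_def simp_thms if_True of_int_add of_int_mult times_divide_eq_right
        add_divide_distrib)
next
  case False
  then have "m + (n + l) \<noteq> 0" "n + (l + m) \<noteq> 0" "l + (m + n) \<noteq> 0"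
    by (simp_all add: algebra_simps)
  then show ?thesis by (simp add: w22_cocycle_def)
qed

lemma pm_scale_single: "pm_scale c (Poly_Mapping.single b d) = Poly_Mapping.single b (c * d)"
  by (rule poly_mapping_eqI) (simp add: lookup_single when_def)

abbreviation (input) w22_jacobiator where
  "w22_jacobiator x y z \<equiv>
     w22_bracket x (w22_bracket y z) + w22_bracket y (w22_bracket z x) + w22_bracket z (w22_bracket x y)"

lemma w22_bracket_basis:
  "w22_bracket (Poly_Mapping.single (BL m) 1) (Poly_Mapping.single (BL n) c) =
     Poly_Mapping.single (BL (m + n)) (c * of_int (n - m)) + Poly_Mapping.single BC1 (c * w22_cocycle m n)"
  "w22_bracket (Poly_Mapping.single (BL m) 1) (Poly_Mapping.single (BW n) c) =
     Poly_Mapping.single (BW (m + n)) (c * of_int (n - m)) + Poly_Mapping.single BC2 (c * w22_cocycle m n)"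
  "w22_bracket (Poly_Mapping.single (BW n) 1) (Poly_Mapping.single (BL m) c) =
     Poly_Mapping.single (BW (m + n)) (- (c * of_int (n - m))) + Poly_Mapping.single BC2 (- (c * w22_cocycle m n))"
  "w22_bracket x (Poly_Mapping.single BC1 c) = 0"
  "w22_bracket x (Poly_Mapping.single BC2 c) = 0"
proof -
  have z: "w22_basis_bracket a BC1 = 0" "w22_basis_bracket a BC2 = 0" for a
    by (cases a; simp)+
  show "w22_bracket x (Poly_Mapping.single BC1 c) = 0" "w22_bracket x (Poly_Mapping.single BC2 c) = 0"
    by (simp_all add: w22_bracket_def pm_scale_vector_space z) (simp_all add: lin_ext_def)
qed (simp_all only: w22_bracket_single w22_basis_bracket.simps pm.scale_right_distrib pm_scale_single
      mult_1 single_uminus pm.scale_minus_right minus_add_distrib)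

lemma w22_jacobi_LLL:
  "w22_jacobiator (Poly_Mapping.single (BL m) 1) (Poly_Mapping.single (BL n) 1) (Poly_Mapping.single (BL l) 1) = 0"
    (is "?J = 0")
proof -
  let ?c = "of_int (l - n) * (of_int (n + l - m) :: complex) + of_int (m - l) * of_int (l + m - n)
    + of_int (n - m) * of_int (m + n - l)"
  have c: "?c = 0"
    by (simp add: algebra_simps)
  have "?J = Poly_Mapping.single (BL (m + (n + l))) ?c + Poly_Mapping.single BC1
     (of_int (l - n) * w22_cocycle m (n + l) + of_int (m - l) * w22_cocycle n (l + m)
     + of_int (n - m) * w22_cocycle l (m + n))"
    by (simp only: w22_bracket_basis w22_bracket_add_right single_add mult_1 add_0_left add_0_right add_ac)
  then show ?thesis by (simp only: c w22_cocycle_identity single_zero add_0_right)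
qed

lemma w22_jacobi_LLW:
  "w22_jacobiator (Poly_Mapping.single (BL m) 1) (Poly_Mapping.single (BL n) 1) (Poly_Mapping.single (BW l) 1) = 0"
    (is "?J = 0")
proof -
  let ?c = "of_int (l - n) * (of_int (n + l - m) :: complex) + - (of_int (l - m) * of_int (m + l - n))
    + - (of_int (n - m) * of_int (l - (m + n)))"
  let ?d = "of_int (l - n) * w22_cocycle m (n + l) + - (of_int (l - m) * w22_cocycle n (m + l))
    + - (of_int (n - m) * w22_cocycle (m + n) l)"
  have c: "?c = 0"
    by (simp add: algebra_simps)
  have "of_int (m - l) = - (of_int (l - m) :: complex)" by simp
  then have d: "?d = 0"
    using w22_cocycle_identity[of l n m] w22_cocycle_antisym[of "m + n" l]
    by (simp add: add.commute[of l m] left_diff_distrib)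
  have "?J = Poly_Mapping.single (BW (m + (n + l))) ?c + Poly_Mapping.single BC2 ?d"
    by (simp only: w22_bracket_basis w22_bracket_add_right single_add mult_1 add_0_left add_0_right add_ac
        mult_minus_left)
  then show ?thesis by (simp only: c d single_zero add_0_right)
qed

lemma w22_jacobi_basis:
  "w22_jacobiator (Poly_Mapping.single a 1) (Poly_Mapping.single b 1) (Poly_Mapping.single c 1) = 0"
proof -
  have LWL: "w22_jacobiator (Poly_Mapping.single (BL m) 1) (Poly_Mapping.single (BW l) 1)
      (Poly_Mapping.single (BL n) 1) = 0"
    and WLL: "w22_jacobiator (Poly_Mapping.single (BW l) 1) (Poly_Mapping.single (BL m) 1)
      (Poly_Mapping.single (BL n) 1) = 0" for m n l
    using w22_jacobi_LLW[of n m l] w22_jacobi_LLW[of m n l] by (simp_all only: add_ac)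
  show ?thesis
    by (cases a; cases b; cases c; (simp only: w22_jacobi_LLL w22_jacobi_LLW LWL WLL)?)
      (simp_all only: w22_bracket_single w22_basis_bracket.simps w22_bracket_basis
        w22_bracket_add_right w22_bracket_minus w22_bracket_diff w22_bracket_zero
        w22_bracket_scale_right pm.scale_right_distrib pm.scale_minus_right pm.scale_zero_right
        add_0_left add_0_right minus_zero)
qed

lemma w22_jacobi: "w22_jacobiator x y z = 0"
proof (induction x rule: pm_induct)
  case (single a)
  show ?case
  proof (induction y rule: pm_induct)
    case (single b)
    show ?case
    proof (induction z rule: pm_induct)
      case (single c)
      show ?case by (rule w22_jacobi_basis)
    next
      case (add p q)
      let ?J = "\<lambda>z. w22_jacobiator (Poly_Mapping.single a 1) (Poly_Mapping.single b 1) z"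
      have "?J (p + q) = ?J p + ?J q" by (simp only: w22_bracket_linear add_ac)
      then show ?case using add by simp
    qed (simp add: w22_bracket_linear flip: pm.scale_right_distrib)
  next
    case (add p q)
    let ?J = "\<lambda>y. w22_jacobiator (Poly_Mapping.single a 1) y z"
    have "?J (p + q) = ?J p + ?J q" by (simp only: w22_bracket_linear add_ac)
    then show ?case using add by simp
  qed (simp add: w22_bracket_linear flip: pm.scale_right_distrib)
next
  case (add p q)
  let ?J = "\<lambda>x. w22_jacobiator x y z"
  have "?J (p + q) = ?J p + ?J q" by (simp only: w22_bracket_linear add_ac)
  then show ?case using add by simp
qed (simp add: w22_bracket_linear flip: pm.scale_right_distrib)

typedef w22 = "UNIV :: (w22_basis \<Rightarrow>\<^sub>0 complex) set"
  morphisms w22_coords w22_of_coords ..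

setup_lifting type_definition_w22

instantiation w22 :: complex_lie_algebra
begin

lift_definition zero_w22 :: w22 is 0 .
lift_definition plus_w22 :: "w22 \<Rightarrow> w22 \<Rightarrow> w22" is "(+)" .
lift_definition minus_w22 :: "w22 \<Rightarrow> w22 \<Rightarrow> w22" is "(-)" .
lift_definition uminus_w22 :: "w22 \<Rightarrow> w22" is uminus .
lift_definition scaleL_w22 :: "complex \<Rightarrow> w22 \<Rightarrow> w22" is pm_scale .
lift_definition bracket_w22 :: "w22 \<Rightarrow> w22 \<Rightarrow> w22" is w22_bracket .

instance
proof
  fix x y z :: w22 and c d :: complex
  show "x + y + z = x + (y + z)" "x + y = y + x" "0 + x = x" "- x + x = 0" "x - y = x + - y"
    by (transfer; simp add: add_ac)+
  show "c *\<^sub>C (x + y) = c *\<^sub>C x + c *\<^sub>C y" "(c + d) *\<^sub>C x = c *\<^sub>C x + d *\<^sub>C x"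
    "c *\<^sub>C d *\<^sub>C x = (c * d) *\<^sub>C x" "1 *\<^sub>C x = x"
    by (transfer; simp add: pm.scale_right_distrib pm.scale_left_distrib)+
  show "bracket (x + y) z = bracket x z + bracket y z" "bracket x (y + z) = bracket x y + bracket x z"
    "bracket (c *\<^sub>C x) y = c *\<^sub>C bracket x y" "bracket x (c *\<^sub>C y) = c *\<^sub>C bracket x y"
    by (transfer; simp only: w22_bracket_linear)+
  show "bracket x x = 0"
    by transfer (rule w22_bracket_self)
  show "bracket x (bracket y z) + bracket y (bracket z x) + bracket z (bracket x y) = 0"
    by transfer (rule w22_jacobi)
qed

end

definition w22_L :: "int \<Rightarrow> w22" where "w22_L n = w22_of_coords (Poly_Mapping.single (BL n) 1)"
definition w22_W :: "int \<Rightarrow> w22" where "w22_W n = w22_of_coords (Poly_Mapping.single (BW n) 1)"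
definition w22_C1 :: w22 where "w22_C1 = w22_of_coords (Poly_Mapping.single BC1 1)"
definition w22_C2 :: w22 where "w22_C2 = w22_of_coords (Poly_Mapping.single BC2 1)"

lemma w22_coords_simps:
  "w22_coords (w22_L n) = Poly_Mapping.single (BL n) 1"
  "w22_coords (w22_W n) = Poly_Mapping.single (BW n) 1"
  "w22_coords w22_C1 = Poly_Mapping.single BC1 1"
  "w22_coords w22_C2 = Poly_Mapping.single BC2 1"
  "w22_coords 0 = 0"
  "w22_coords (x + y) = w22_coords x + w22_coords y"
  "w22_coords (c *\<^sub>C x) = pm_scale c (w22_coords x)"
  "w22_coords (bracket x y) = w22_bracket (w22_coords x) (w22_coords y)"
  by (simp_all add: w22_L_def w22_W_def w22_C1_def w22_C2_def w22_of_coords_inverse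
      zero_w22.rep_eq plus_w22.rep_eq scaleL_w22.rep_eq bracket_w22.rep_eq)

lemma bracket_w22_L_L: "bracket (w22_L m) (w22_L n) =
  of_int (n - m) *\<^sub>C w22_L (m + n) + (if m + n = 0 then of_int (m ^ 3 - m) / 12 else 0) *\<^sub>C w22_C1"
  by (simp only: w22_coords_inject[symmetric] w22_coords_simps w22_bracket_basis pm_scale_single
      w22_cocycle_def mult_1 mult_1_right)

lemma bracket_w22_L_W: "bracket (w22_L m) (w22_W n) =
  of_int (n - m) *\<^sub>C w22_W (m + n) + (if m + n = 0 then of_int (m ^ 3 - m) / 12 else 0) *\<^sub>C w22_C2"
  by (simp only: w22_coords_inject[symmetric] w22_coords_simps w22_bracket_basis pm_scale_single
      w22_cocycle_def mult_1 mult_1_right)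

lemma bracket_w22_W_W: "bracket (w22_W m) (w22_W n) = 0"
  by (simp only: w22_coords_inject[symmetric] w22_coords_simps w22_bracket_single
      w22_basis_bracket.simps pm.scale_zero_right)

lemma bracket_w22_central: "bracket w22_C1 x = 0" "bracket w22_C2 x = 0"
  by (simp_all add: w22_coords_inject[symmetric] w22_coords_simps w22_bracket_def
      pm_scale_vector_space) (simp_all add: lin_ext_def)

lemma scaleL_vector_space: "vector_space (scaleL :: complex \<Rightarrow> 'g::complex_lie_algebra \<Rightarrow> 'g)"
  by unfold_locales (simp_all add: scaleL_add_left scaleL_add_right scaleL_scaleL scaleL_one)

interpretation lie: vector_space "scaleL :: complex \<Rightarrow> 'g::complex_lie_algebra \<Rightarrow> 'g"
  by (rule scaleL_vector_space)

typedef cartan22 = "{x. \<exists>a b. x = a *\<^sub>C w22_L 0 + b *\<^sub>C w22_W 0}"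
  morphisms cartan22_incl cartan22_of by blast

lemma bracket_cartan22:
  "bracket (a *\<^sub>C w22_L 0 + b *\<^sub>C w22_W 0) (a' *\<^sub>C w22_L 0 + b' *\<^sub>C w22_W 0) = 0"
proof -
  have "bracket (w22_W 0) (w22_L 0) = 0"
    by (simp add: w22_coords_inject[symmetric] w22_coords_simps w22_bracket_basis w22_cocycle_def)
  then show ?thesis
    by (simp add: bracket_add_left bracket_add_right bracket_scaleL_left bracket_scaleL_right
        bracket_w22_L_W bracket_self)
qed

lemma cartan22_closed:
  defines "H \<equiv> \<lambda>x. \<exists>a b. x = a *\<^sub>C w22_L 0 + b *\<^sub>C w22_W 0"
  shows "H 0" "H x \<Longrightarrow> H y \<Longrightarrow> H (x + y)" "H x \<Longrightarrow> H y \<Longrightarrow> H (x - y)"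
    "H x \<Longrightarrow> H (- x)" "H x \<Longrightarrow> H (c *\<^sub>C x)" "H x \<Longrightarrow> H y \<Longrightarrow> H (bracket x y)"
proof -
  have H: "H (a *\<^sub>C w22_L 0 + b *\<^sub>C w22_W 0)" for a b
    unfolding H_def by blast
  show 0: "H 0" using H[of 0 0] by simp
  show add: "H (x + y)" if xy: "H x" "H y" for x y
  proof -
    obtain a b a' b' where "x = a *\<^sub>C w22_L 0 + b *\<^sub>C w22_W 0" "y = a' *\<^sub>C w22_L 0 + b' *\<^sub>C w22_W 0"
      using xy unfolding H_def by blast
    then show ?thesis
      using H[of "a + a'" "b + b'"] by (simp only: scaleL_add_left add_ac)
  qed
  show scale: "H (c *\<^sub>C x)" if x: "H x" for c x
  proof -
    obtain a b where "x = a *\<^sub>C w22_L 0 + b *\<^sub>C w22_W 0"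
      using x unfolding H_def by blast
    then show ?thesis
      using H[of "c * a" "c * b"] by (simp only: scaleL_add_right scaleL_scaleL)
  qed
  show minus: "H (- x)" if "H x" for x
    using scale[OF that, of "- 1"] by simp
  show "H (x - y)" if "H x" "H y" for x y
    using add[OF that(1) minus[OF that(2)]] by simp
  show "H (bracket x y)" if xy: "H x" "H y"
  proof -
    obtain a b a' b' where "x = a *\<^sub>C w22_L 0 + b *\<^sub>C w22_W 0" "y = a' *\<^sub>C w22_L 0 + b' *\<^sub>C w22_W 0"
      using xy unfolding H_def by blast
    then show ?thesis using 0 by (simp only: bracket_cartan22)
  qed
qed

setup_lifting type_definition_cartan22

instantiation cartan22 :: complex_lie_algebra
begin

lift_definition zero_cartan22 :: cartan22 is 0
  by (fact cartan22_closed)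

lift_definition plus_cartan22 :: "cartan22 \<Rightarrow> cartan22 \<Rightarrow> cartan22" is "(+)"
  by (fact cartan22_closed)

lift_definition minus_cartan22 :: "cartan22 \<Rightarrow> cartan22 \<Rightarrow> cartan22" is "(-)"
  by (fact cartan22_closed)

lift_definition uminus_cartan22 :: "cartan22 \<Rightarrow> cartan22" is uminus
  by (fact cartan22_closed)

lift_definition scaleL_cartan22 :: "complex \<Rightarrow> cartan22 \<Rightarrow> cartan22" is scaleL
  by (fact cartan22_closed)

lift_definition bracket_cartan22 :: "cartan22 \<Rightarrow> cartan22 \<Rightarrow> cartan22" is bracket
  by (fact cartan22_closed)

instance
proof
  fix x y z :: cartan22 and c d :: complex
  show "x + y + z = x + (y + z)" "x + y = y + x" "0 + x = x" "- x + x = 0" "x - y = x + - y"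
    by (transfer; simp add: add_ac)+
  show "c *\<^sub>C (x + y) = c *\<^sub>C x + c *\<^sub>C y" "(c + d) *\<^sub>C x = c *\<^sub>C x + d *\<^sub>C x"
    "c *\<^sub>C d *\<^sub>C x = (c * d) *\<^sub>C x" "1 *\<^sub>C x = x"
    by (transfer; rule scaleL_add_right scaleL_add_left scaleL_scaleL scaleL_one)+
  show "bracket (x + y) z = bracket x z + bracket y z" "bracket x (y + z) = bracket x y + bracket x z"
    "bracket (c *\<^sub>C x) y = c *\<^sub>C bracket x y" "bracket x (c *\<^sub>C y) = c *\<^sub>C bracket x y"
    "bracket x x = 0"
    "bracket x (bracket y z) + bracket y (bracket z x) + bracket z (bracket x y) = 0"
    by (transfer; rule bracket_add_left bracket_add_right bracket_scaleL_left bracket_scaleL_right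
        bracket_self jacobi)+
qed

end

lemma lie_hom_cartan22_incl: "lie_hom cartan22_incl"
  unfolding lie_hom_def by (simp add: plus_cartan22.rep_eq scaleL_cartan22.rep_eq bracket_cartan22.rep_eq)

text \<open>
  \<open>U(g)\<close> is the free unital associative algebra on the underlying set of \<open>g\<close> (finite linear
  combinations of words with letters in \<open>g\<close>), modulo the two-sided ideal that makes the map
  \<open>g \<rightarrow> U(g)\<close> linear and turns brackets into commutators. The first two families
  of relations alone present the tensor algebra of \<open>g\<close>.
\<close>

datatype 'a word = Word "'a list"

instantiation word :: (type) monoid_add
begin

definition zero_word :: "'a word" where "zero_word = Word []"

fun plus_word :: "'a word \<Rightarrow> 'a word \<Rightarrow> 'a word" where
  "plus_word (Word xs) (Word ys) = Word (xs @ ys)"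

instance
proof
  fix u v w :: "'a word"
  show "u + v + w = u + (v + w)" by (cases u; cases v; cases w) simp
  show "0 + u = u" "u + 0 = u" by (cases u; simp add: zero_word_def)+
qed

end

type_synonym 'a free_alg = "'a word \<Rightarrow>\<^sub>0 complex"

definition free_letter :: "'a \<Rightarrow> 'a free_alg" where
  "free_letter x = Poly_Mapping.single (Word [x]) 1"

definition free_const :: "complex \<Rightarrow> 'a free_alg" where
  "free_const c = Poly_Mapping.single 0 c"

lemma pm_scale_mult: "pm_scale c p * q = pm_scale c (p * q)"
  by (simp add: pm_scale_def mult_map_scale_conv_mult mult.assoc)

lemma mult_pm_scale:
  fixes p q :: "'a free_alg"
  shows "p * pm_scale c q = pm_scale c (p * q)"
proof (induction p rule: pm_induct)
  case (single u)
  show ?case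
  proof (induction q arbitrary: c rule: pm_induct)
    case (scale d q)
    show ?case by (simp only: pm.scale_scale scale.IH)
  qed (simp_all add: pm_scale_single mult_single distrib_left pm.scale_right_distrib)
qed (simp_all add: pm_scale_mult distrib_right pm.scale_right_distrib pm.scale_left_commute)

inductive_set uea_ideal :: "'g::complex_lie_algebra free_alg set" where
  letter_add: "free_letter (x + y) - (free_letter x + free_letter y) \<in> uea_ideal"
| letter_scaleL: "free_letter (c *\<^sub>C x) - free_const c * free_letter x \<in> uea_ideal"
| letter_bracket: "free_letter (bracket x y) -
    (free_letter x * free_letter y - free_letter y * free_letter x) \<in> uea_ideal"
| zero: "0 \<in> uea_ideal"
| add: "p \<in> uea_ideal \<Longrightarrow> q \<in> uea_ideal \<Longrightarrow> p + q \<in> uea_ideal"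
| mult_left: "p \<in> uea_ideal \<Longrightarrow> r * p \<in> uea_ideal"
| mult_right: "p \<in> uea_ideal \<Longrightarrow> p * r \<in> uea_ideal"

lemma uea_ideal_uminus: "p \<in> uea_ideal \<Longrightarrow> - p \<in> uea_ideal"
  using uea_ideal.mult_left[of p "- 1"] by simp

lemma free_lookup_mult_zero:
  fixes p q :: "'a free_alg"
  shows "Poly_Mapping.lookup (p * q) 0 = Poly_Mapping.lookup p 0 * Poly_Mapping.lookup q 0"
proof (induction p rule: pm_induct)
  case (single u)
  show ?case
  proof (induction q rule: pm_induct)
    case (single v)
    have "u + v = 0 \<longleftrightarrow> u = 0 \<and> v = 0"
      by (cases u; cases v) (simp add: zero_word_def)
    then show ?case by (simp add: mult_single lookup_single when_def)
  next
    case (scale c q)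
    then show ?case by (simp add: mult_pm_scale)
  qed (simp add: distrib_left lookup_add)
next
  case (scale c p)
  then show ?case by (simp add: pm_scale_mult)
qed (simp add: distrib_right lookup_add)

lemma free_lookup_letter_zero: "Poly_Mapping.lookup (free_letter x) 0 = 0"
  by (simp add: free_letter_def lookup_single zero_word_def)

lemma uea_ideal_lookup_zero: "p \<in> uea_ideal \<Longrightarrow> Poly_Mapping.lookup p 0 = 0"
  by (induction rule: uea_ideal.induct)
    (simp_all add: lookup_minus lookup_add free_lookup_mult_zero free_lookup_letter_zero)

definition uea_cong :: "'g::complex_lie_algebra free_alg \<Rightarrow> 'g free_alg \<Rightarrow> bool" where
  "uea_cong p q \<longleftrightarrow> p - q \<in> uea_ideal"

lemma uea_cong_equivp: "equivp (uea_cong :: 'g::complex_lie_algebra free_alg \<Rightarrow> _)"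
proof (rule equivpI)
  show "reflp (uea_cong :: 'g free_alg \<Rightarrow> _)"
    by (simp add: reflp_def uea_cong_def uea_ideal.zero)
  show "symp (uea_cong :: 'g free_alg \<Rightarrow> _)"
    unfolding symp_def uea_cong_def using uea_ideal_uminus by force
  show "transp (uea_cong :: 'g free_alg \<Rightarrow> _)"
    unfolding transp_def uea_cong_def using uea_ideal.add by force
qed

quotient_type (overloaded) 'g uea = "'g::complex_lie_algebra free_alg" / uea_cong
  by (rule uea_cong_equivp)

instantiation uea :: (complex_lie_algebra) ring_1
begin

lift_definition zero_uea :: "'a uea" is 0 .
lift_definition one_uea :: "'a uea" is 1 .

lift_definition plus_uea :: "'a uea \<Rightarrow> 'a uea \<Rightarrow> 'a uea" is "(+)"
  unfolding uea_cong_def add_diff_add by (rule uea_ideal.add)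

lift_definition uminus_uea :: "'a uea \<Rightarrow> 'a uea" is uminus
  unfolding uea_cong_def minus_diff_minus by (rule uea_ideal_uminus)

lift_definition minus_uea :: "'a uea \<Rightarrow> 'a uea \<Rightarrow> 'a uea" is "(-)"
proof -
  fix p p' q q' :: "'a free_alg"
  assume "uea_cong p p'" "uea_cong q q'"
  then have "(p - p') + - (q - q') \<in> uea_ideal"
    unfolding uea_cong_def by (intro uea_ideal.add uea_ideal_uminus)
  then show "uea_cong (p - q) (p' - q')" unfolding uea_cong_def by (simp add: algebra_simps)
qed

lift_definition times_uea :: "'a uea \<Rightarrow> 'a uea \<Rightarrow> 'a uea" is "(*)"
proof -
  fix p p' q q' :: "'a free_alg"
  assume "uea_cong p p'" "uea_cong q q'"
  then have "(p - p') * q + p' * (q - q') \<in> uea_ideal"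
    unfolding uea_cong_def by (intro uea_ideal.add uea_ideal.mult_left uea_ideal.mult_right)
  then show "uea_cong (p * q) (p' * q')" unfolding uea_cong_def by (simp add: algebra_simps)
qed

instance
proof
  fix a b c :: "'a uea"
  show "a + b + c = a + (b + c)" "a + b = b + a" "0 + a = a" "- a + a = 0" "a - b = a + - b"
    "a * b * c = a * (b * c)" "1 * a = a" "a * 1 = a"
    "(a + b) * c = a * c + b * c" "a * (b + c) = a * b + a * c"
    by (transfer; simp add: uea_cong_def uea_ideal.zero add.assoc add.commute mult.assoc
        distrib_left distrib_right)+
  have "(1 :: 'a free_alg) \<notin> uea_ideal"
    using uea_ideal_lookup_zero[of "1 :: 'a free_alg"] by auto
  then have "\<not> uea_cong 1 (0 :: 'a free_alg)"
    by (simp add: uea_cong_def)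
  then show "(0 :: 'a uea) \<noteq> 1"
    unfolding zero_uea_def one_uea_def using uea.abs_eq_iff by metis
qed

end

lift_definition uea_of :: "'g::complex_lie_algebra \<Rightarrow> 'g uea" is free_letter .

lift_definition uea_const :: "complex \<Rightarrow> 'g::complex_lie_algebra uea" is free_const .

lemma uea_of_add: "uea_of (x + y) = uea_of x + uea_of y"
  by (simp only: uea_of.abs_eq plus_uea.abs_eq uea.abs_eq_iff uea_cong_def uea_ideal.letter_add)

lemma uea_of_scaleL: "uea_of (c *\<^sub>C x) = uea_const c * uea_of x"
  by (simp only: uea_of.abs_eq uea_const.abs_eq times_uea.abs_eq uea.abs_eq_iff uea_cong_def
      uea_ideal.letter_scaleL)

lemma uea_of_bracket: "uea_of (bracket x y) = uea_of x * uea_of y - uea_of y * uea_of x"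
  by (simp only: uea_of.abs_eq times_uea.abs_eq minus_uea.abs_eq uea.abs_eq_iff uea_cong_def
      uea_ideal.letter_bracket)

lemma uea_const_add: "uea_const (c + d) = uea_const c + uea_const d"
  by (simp only: uea_const.abs_eq plus_uea.abs_eq free_const_def single_add)

lemma uea_const_mult: "uea_const (c * d) = uea_const c * uea_const d"
  by (simp only: uea_const.abs_eq times_uea.abs_eq free_const_def mult_single add_0_right)

lemma uea_const_one: "uea_const 1 = 1"
  by (simp only: uea_const.abs_eq one_uea_def free_const_def single_one)

lemma uea_const_commute: "uea_const c * u = u * uea_const c"
proof -
  obtain p where u: "u = abs_uea p"
    by (metis Quotient3_abs_rep[OF Quotient3_uea])
  have "free_const c * p = pm_scale c p"
    by (simp add: free_const_def pm_scale_def mult_map_scale_conv_mult)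
  moreover have "p * free_const c = pm_scale c p"
    using mult_pm_scale[of p c 1] by (simp add: free_const_def pm_scale_def mult_map_scale_conv_mult)
  ultimately show ?thesis
    by (simp only: u uea_const.abs_eq times_uea.abs_eq)
qed

definition free_map :: "('a \<Rightarrow> 'b) \<Rightarrow> 'a free_alg \<Rightarrow> 'b free_alg" where
  "free_map f = lin_ext pm_scale (\<lambda>w. Poly_Mapping.single (map_word f w) 1)"

text \<open>
  The algebra homomorphism \<open>U(f)\<close>. It is only meaningful if \<open>f\<close> is a Lie algebra
  homomorphism: the value is then independent of the chosen representative (see \<open>uea_map_abs\<close>).
\<close>

definition uea_map :: "('g::complex_lie_algebra \<Rightarrow> 'h::complex_lie_algebra) \<Rightarrow> 'g uea \<Rightarrow> 'h uea" where
  "uea_map f u = abs_uea (free_map f (rep_uea u))"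

lemma free_map_single: "free_map f (Poly_Mapping.single w c) = Poly_Mapping.single (map_word f w) c"
  by (simp add: free_map_def pm_scale_vector_space pm_scale_single)

lemma free_map_add: "free_map f (p + q) = free_map f p + free_map f q"
  by (simp add: free_map_def lin_ext_add pm_scale_vector_space)

lemma free_map_pm_scale: "free_map f (pm_scale c p) = pm_scale c (free_map f p)"
  by (simp add: free_map_def lin_ext_scale pm_scale_vector_space)

lemma free_map_diff: "free_map f (p - q) = free_map f p - free_map f q"
  using free_map_add[of f "p - q" q] by (simp add: eq_diff_eq)

lemma map_word_add: "map_word f (u + v) = map_word f u + map_word f v"
  by (cases u; cases v) simp

lemma free_map_mult: "free_map f (p * q) = free_map f p * free_map f q"
proof (induction p rule: pm_induct)
  case (single u)
  show ?case
  proof (induction q rule: pm_induct)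
    case (single v)
    show ?case by (simp add: free_map_single mult_single map_word_add)
  qed (simp_all add: free_map_add free_map_pm_scale mult_pm_scale distrib_left)
qed (simp_all add: free_map_add free_map_pm_scale pm_scale_mult distrib_right)

lemma free_map_letter: "free_map f (free_letter x) = free_letter (f x)"
  by (simp add: free_letter_def free_map_single)

lemma free_map_const: "free_map f (free_const c) = free_const c"
  by (simp add: free_const_def free_map_single zero_word_def)

lemma free_map_ideal:
  assumes "lie_hom f" "p \<in> uea_ideal"
  shows "free_map f p \<in> uea_ideal"
  using assms(2)
proof induction
  case zero
  show ?case using uea_ideal.zero by (simp add: free_map_def lin_ext_def)
qed (use assms(1) in \<open>simp_all add: lie_hom_def free_map_add free_map_diff free_map_mult
  free_map_letter free_map_const uea_ideal.intros\<close>)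

lemma uea_map_abs:
  assumes "lie_hom f"
  shows "uea_map f (abs_uea p) = abs_uea (free_map f p)"
proof -
  have "uea_cong (rep_uea (abs_uea p)) p"
    by (rule Quotient3_rep_abs[OF Quotient3_uea]) (rule equivp_reflp[OF uea_cong_equivp])
  then have "free_map f (rep_uea (abs_uea p)) - free_map f p \<in> uea_ideal"
    unfolding uea_cong_def free_map_diff[symmetric] by (rule free_map_ideal[OF assms])
  then show ?thesis
    unfolding uea_map_def uea.abs_eq_iff uea_cong_def .
qed

lemma uea_map_hom:
  assumes "lie_hom f"
  shows "uea_map f (u + v) = uea_map f u + uea_map f v"
    and "uea_map f (u * v) = uea_map f u * uea_map f v"
    and "uea_map f 1 = 1"
    and "uea_map f (uea_const c) = uea_const c"
    and "uea_map f (uea_of x) = uea_of (f x)"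
proof -
  obtain p q where uv: "u = abs_uea p" "v = abs_uea q"
    using Quotient3_abs_rep[OF Quotient3_uea, of u] Quotient3_abs_rep[OF Quotient3_uea, of v] by metis
  show "uea_map f (u + v) = uea_map f u + uea_map f v"
    by (simp only: uv plus_uea.abs_eq uea_map_abs[OF assms] free_map_add)
  show "uea_map f (u * v) = uea_map f u * uea_map f v"
    by (simp only: uv times_uea.abs_eq uea_map_abs[OF assms] free_map_mult)
  show c: "uea_map f (uea_const c) = uea_const c" for c
    by (simp only: uea_const.abs_eq uea_map_abs[OF assms] free_map_const)
  show "uea_map f 1 = 1" using c[of 1] by (simp add: uea_const_one)
  show "uea_map f (uea_of x) = uea_of (f x)"
    by (simp only: uea_of.abs_eq uea_map_abs[OF assms] free_map_letter)
qed

locale left_module =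
  fixes act :: "'r::ring_1 \<Rightarrow> 'm::ab_group_add \<Rightarrow> 'm"
  assumes act_add_right: "act r (x + y) = act r x + act r y"
    and act_add_left: "act (r + s) x = act r x + act s x"
    and act_mult: "act (r * s) x = act r (act s x)"
    and act_one: "act 1 x = x"

definition module_basis :: "('r::ring_1 \<Rightarrow> 'm::ab_group_add \<Rightarrow> 'm) \<Rightarrow> 'm set \<Rightarrow> bool" where
  "module_basis act B \<longleftrightarrow>
     (\<forall>x. \<exists>!c. finite {b. c b \<noteq> 0} \<and> {b. c b \<noteq> 0} \<subseteq> B \<and> x = (\<Sum>b | c b \<noteq> 0. act (c b) b))"

definition free_of_rank :: "('r::ring_1 \<Rightarrow> 'm::ab_group_add \<Rightarrow> 'm) \<Rightarrow> nat \<Rightarrow> bool" where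
  "free_of_rank act n \<longleftrightarrow> left_module act \<and> (\<exists>B. finite B \<and> card B = n \<and> module_basis act B)"

lemma left_module_restrict:
  assumes "left_module act" "lie_hom f"
  shows "left_module (\<lambda>u. act (uea_map f u))"
proof -
  interpret left_module act by fact
  show ?thesis
    by unfold_locales (simp_all add: uea_map_hom[OF assms(2)] act_add_left act_add_right act_mult act_one)
qed

lemma left_module_lie_module:
  fixes act :: "'g::complex_lie_algebra uea \<Rightarrow> 'm::ab_group_add \<Rightarrow> 'm"
  assumes "left_module act"
  shows "lie_module (\<lambda>c. act (uea_const c)) (\<lambda>x. act (uea_of x))"
proof -
  interpret left_module act by fact
  interpret vs: vector_space "\<lambda>c. act (uea_const c)"
    by unfold_locales (simp_all add: act_add_left act_add_right uea_const_add uea_const_mult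
        uea_const_one act_one flip: act_mult)
  have minus: "act (r - s) x = act r x - act s x" for r s x
    using act_add_left[of "r - s" s x] by simp
  show ?thesis
  proof unfold_locales
    show "act (uea_of x) (y + z) = act (uea_of x) y + act (uea_of x) z" for x y z
      by (rule act_add_right)
    show "act (uea_of x) (act (uea_const c) v) = act (uea_const c) (act (uea_of x) v)" for x c v
      by (simp flip: act_mult add: uea_const_commute)
  qed (simp_all add: uea_of_add uea_of_scaleL uea_of_bracket act_add_left act_mult minus)
qed

definition h_poly :: "complex \<Rightarrow> int \<Rightarrow> nat \<Rightarrow> complex poly" where
  "h_poly \<alpha> n k = smult (of_int n) (monom 1 k)
     - smult (of_int (n * (n - 1)) * \<alpha>) (\<Sum>j<k. monom (\<alpha> ^ (k - 1 - j)) j)"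

lemma h_poly_quotient:
  "(\<Sum>j<k. monom (\<alpha> ^ (k - 1 - j)) j) * [:- \<alpha>, 1:] = monom 1 k - [:\<alpha> ^ k :: complex:]"
proof (induction k)
  case (Suc k)
  have "(\<Sum>j<k. monom (\<alpha> ^ (k - j)) j) = (\<Sum>j<k. [:\<alpha>:] * monom (\<alpha> ^ (k - 1 - j)) j)"
  proof (rule sum.cong)
    fix j assume "j \<in> {..<k}"
    then have "k - j = Suc (k - 1 - j)" by simp
    then show "monom (\<alpha> ^ (k - j)) j = [:\<alpha>:] * monom (\<alpha> ^ (k - 1 - j)) j"
      by (simp add: smult_monom)
  qed simp
  then have "(\<Sum>j<Suc k. monom (\<alpha> ^ (Suc k - 1 - j)) j) * [:- \<alpha>, 1:] =
      [:\<alpha>:] * ((\<Sum>j<k. monom (\<alpha> ^ (k - 1 - j)) j) * [:- \<alpha>, 1:]) + monom 1 k * [:- \<alpha>, 1:]"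
    by (simp add: sum_distrib_left distrib_right mult.assoc del: mult_pCons_right mult_pCons_left)
  also have "\<dots> = monom 1 (Suc k) - [:\<alpha> ^ Suc k:]"
    unfolding Suc
    by (rule poly_eqI) (auto simp: coeff_pCons smult_diff_right algebra_simps split: nat.splits)
  finally show ?case .
qed simp

text \<open>\<open>h_poly_quotient\<close> identifies the sum in \<open>h_poly\<close> with
  \<open>(t ^ k - \<alpha> ^ k) / (t - \<alpha>)\<close>.\<close>

definition H_family :: "complex \<Rightarrow> (int \<Rightarrow> complex poly) set" where
  "H_family \<alpha> = {h. \<exists>\<xi> :: nat \<Rightarrow> complex. finite {i. \<xi> i \<noteq> 0} \<and>
     (\<forall>n. h n = (\<Sum>i | \<xi> i \<noteq> 0. smult (\<xi> i) (h_poly \<alpha> n i)))}"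

text \<open>
  \<open>\<complex>[t, s]\<close> is represented by \<^typ>\<open>complex poly poly\<close>, with \<open>s\<close> the outer and \<open>t\<close> the inner variable:
  \<open>[:p, 1:]\<close> is \<open>s + p(t)\<close>, and \<open>[:[:- c, 1:]:]\<close> is \<open>t - c\<close>.
\<close>

definition poly2_scale :: "complex \<Rightarrow> complex poly poly \<Rightarrow> complex poly poly" where
  "poly2_scale c = smult [:c:]"

definition shift_s :: "int \<Rightarrow> complex poly poly \<Rightarrow> complex poly poly" where
  "shift_s m f = pcompose f [:- of_int m, 1:]"

definition deriv_t :: "complex poly poly \<Rightarrow> complex poly poly" where
  "deriv_t f = map_poly pderiv f"

fun omega_basis_act :: "complex \<Rightarrow> complex \<Rightarrow> (int \<Rightarrow> complex poly) \<Rightarrow>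
    w22_basis \<Rightarrow> complex poly poly \<Rightarrow> complex poly poly" where
  "omega_basis_act lam \<alpha> h (BL m) f =
     poly2_scale (lam powi m) ([:h m, 1:] * shift_s m f)
     - poly2_scale (of_int m * lam powi m) ([:[:- (of_int m * \<alpha>), 1:]:] * deriv_t (shift_s m f))"
| "omega_basis_act lam \<alpha> h (BW m) f =
     poly2_scale (lam powi m) ([:[:- (of_int m * \<alpha>), 1:]:] * shift_s m f)"
| "omega_basis_act lam \<alpha> h BC1 f = 0"
| "omega_basis_act lam \<alpha> h BC2 f = 0"

definition omega_act :: "complex \<Rightarrow> complex \<Rightarrow> (int \<Rightarrow> complex poly) \<Rightarrow>
    w22 \<Rightarrow> complex poly poly \<Rightarrow> complex poly poly" where
  "omega_act lam \<alpha> h x f = lin_ext poly2_scale (\<lambda>b. omega_basis_act lam \<alpha> h b f) (w22_coords x)"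

lemma poly2_scale_vector_space: "vector_space poly2_scale"
proof unfold_locales
  fix a b :: complex and f :: "complex poly poly"
  show "poly2_scale (a + b) f = poly2_scale a f + poly2_scale b f"
    using smult_add_left[of "[:a:]" "[:b:]" f] by (simp add: poly2_scale_def)
  show "poly2_scale 1 f = f"
    by (simp add: poly2_scale_def flip: one_pCons)
qed (simp_all add: poly2_scale_def smult_add_right mult.commute)

lemma omega_act_basis:
  "omega_act lam \<alpha> h (w22_L m) f = omega_basis_act lam \<alpha> h (BL m) f"
  "omega_act lam \<alpha> h (w22_W m) f = omega_basis_act lam \<alpha> h (BW m) f"
  "omega_act lam \<alpha> h w22_C1 f = 0"
  "omega_act lam \<alpha> h w22_C2 f = 0"
proof -
  interpret vector_space poly2_scale by (rule poly2_scale_vector_space)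
  show "omega_act lam \<alpha> h (w22_L m) f = omega_basis_act lam \<alpha> h (BL m) f"
    "omega_act lam \<alpha> h (w22_W m) f = omega_basis_act lam \<alpha> h (BW m) f"
    "omega_act lam \<alpha> h w22_C1 f = 0"
    "omega_act lam \<alpha> h w22_C2 f = 0"
    by (simp_all only: omega_act_def w22_coords_simps lin_ext_single[OF poly2_scale_vector_space]
        scale_one omega_basis_act.simps)
qed

lemma poly_shift_s: "poly (shift_s m f) p = poly f (p - of_int m)"
  by (simp add: shift_s_def poly_pcompose)

lemma coeff_deriv_t: "coeff (deriv_t f) i = pderiv (coeff f i)"
  by (simp add: deriv_t_def coeff_map_poly)

end

theory Submission
  imports Defs
begin

text \<open>
  Freeness of rank \<open>1\<close> identifies the module with \<open>\<complex>[t, s]\<close> so that \<open>L\<^sub>0\<close> is multiplication by \<open>s\<close> and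
  \<open>W\<^sub>0\<close> multiplication by \<open>t\<close>. The brackets with \<open>L\<^sub>0\<close> and \<open>W\<^sub>0\<close> then express \<open>W\<^sub>n\<close> and \<open>L\<^sub>n\<close> through
  \<open>a\<^sub>n = W\<^sub>n \<cdot> 1\<close> and \<open>b\<^sub>n = L\<^sub>n \<cdot> 1\<close>. Since \<open>W\<^sub>1\<close> and \<open>W\<^sub>-\<^sub>1\<close> commute, \<open>a\<^sub>1(s) a\<^sub>-\<^sub>1(s - 1)\<close> is
  invariant under \<open>s \<mapsto> s + 1\<close>, so \<open>a\<^sub>1, a\<^sub>-\<^sub>1 \<in> \<complex>[t]\<close>, and commutation with \<open>W\<^sub>1\<close> puts every
  \<open>a\<^sub>n\<close> in \<open>\<complex>[t]\<close>. The brackets \<open>[L\<^sub>\<plusminus>\<^sub>1, W\<^sub>n]\<close> give \<open>(a\<^sub>1 a\<^sub>-\<^sub>1)' = 2 t\<close> and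
  \<open>(a\<^sub>-\<^sub>2 a\<^sub>1\<^sup>2)' = 3 a\<^sub>1 a\<^sub>-\<^sub>1\<close>, which forces \<open>a\<^sub>1\<close> to be linear in \<open>t\<close> and then
  \<open>a\<^sub>n = \<lambda>\<^sup>n (t - n \<alpha>)\<close> and \<open>b\<^sub>n = \<lambda>\<^sup>n (s + F\<^sub>n(t))\<close>. The family of \<open>\<H>\<^sub>\<alpha>\<close> that agrees with \<open>F\<close> at
  \<open>n = 1\<close> satisfies the same linear equations as \<open>F\<close>, and a solution of these that vanishes at
  \<open>n = 1\<close> is zero.
\<close>

section \<open>Polynomial recurrences\<close>

text \<open>The values at 0, c, 2c, ... all agree, and in characteristic 0 these are infinitely many
  points, so \<open>f - [:poly f 0:]\<close> has infinitely many roots.\<close>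

lemma shift_invariant_imp_degree_0:
  fixes f :: "'a :: {idom, ring_char_0} poly"
  assumes "pcompose f [:c, 1:] = f" "c \<noteq> 0"
  shows "degree f = 0"
proof -
  have step: "poly f (x + c) = poly f x" for x
    using arg_cong[OF assms(1), of "\<lambda>p. poly p x"] by (simp add: poly_pcompose add.commute)
  have "poly f (of_nat k * c) = poly f 0" for k
  proof (induction k)
    case (Suc k)
    show ?case using step[of "of_nat k * c"] Suc by (simp add: algebra_simps)
  qed simp
  then have "range (\<lambda>k. of_nat k * c) \<subseteq> {x. poly (f - [:poly f 0:]) x = 0}"
    by auto
  moreover have "infinite (range (\<lambda>k::nat. of_nat k * c))"
    using assms(2) by (intro range_inj_infinite injI) simp
  ultimately have "f - [:poly f 0:] = 0"
    using poly_roots_finite finite_subset by blast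
  then show ?thesis
    by (metis degree_pCons_0 eq_iff_diff_eq_0)
qed

lemma poly_ext:
  fixes p q :: "'a :: {idom, ring_char_0} poly"
  shows "(\<And>x. poly p x = poly q x) \<Longrightarrow> p = q"
  by (rule poly_eq_poly_eq_iff[THEN iffD1]) (rule ext)

text \<open>On the leading coefficient of a polynomial of degree d the operator acts as
  multiplication by k + d, which is nonzero.\<close>

lemma euler_operator_inj:
  fixes p :: "complex poly"
  assumes "smult (of_nat k) p + pderiv p * [:c, 1:] = 0" "k > 0"
  shows "p = 0"
proof (rule ccontr)
  assume "p \<noteq> 0"
  let ?d = "degree p"
  have "coeff (pderiv p * [:c, 1:]) ?d = of_nat ?d * lead_coeff p"
    by (cases ?d) (auto simp: coeff_pCons coeff_pderiv coeff_eq_0)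
  then have "of_nat k * lead_coeff p + of_nat ?d * lead_coeff p = 0"
    using arg_cong[OF assms(1), of "\<lambda>p. coeff p ?d"] by (simp only: coeff_add coeff_smult coeff_0)
  then have "(of_nat k + of_nat ?d) * lead_coeff p = 0"
    by (simp only: distrib_right)
  moreover have "of_nat k + of_nat ?d \<noteq> (0 :: complex)"
    using \<open>k > 0\<close> by (simp flip: of_nat_add)
  ultimately show False
    using \<open>p \<noteq> 0\<close> by simp
qed

section \<open>The recurrence for the action of the W_n\<close>

text \<open>
  The condition that \<open>[L\<^sub>1, W\<^sub>n] = (n - 1) W\<^sub>n\<^sub>+\<^sub>1\<close> imposes on \<open>A\<^sub>n = W\<^sub>n \<cdot> 1 \<in> \<complex>[t]\<close>. Applied to
  \<open>A\<^sub>-\<^sub>n\<close> it is the condition coming from \<open>L\<^sub>-\<^sub>1\<close>, with no change of sign.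
\<close>

definition W_rec :: "(int \<Rightarrow> complex poly) \<Rightarrow> bool" where
  "W_rec A \<longleftrightarrow> (\<forall>n. smult (of_int n) (A n * pderiv (A 1)) - pderiv (A n) * A 1 =
     smult (of_int (n - 1)) (A (n + 1)))"

lemma W_recD:
  assumes "W_rec A"
  shows "of_int n * (poly (A n) x * poly (pderiv (A 1)) x) - poly (pderiv (A n)) x * poly (A 1) x =
     of_int (n - 1) * poly (A (n + 1)) x"
  using assms[unfolded W_rec_def, THEN spec, of n, THEN arg_cong, of "\<lambda>p. poly p x"] by simp

text \<open>The recurrence at n = -1 has right-hand side \<open>- 2 * A 0\<close>, and its left-hand
  side is minus the derivative of the product.\<close>

lemma W_rec_pderiv_1:
  assumes "W_rec A" "A 0 = [:0, 1:]"
  shows "pderiv (A 1 * A (- 1)) = [:0, 2:]"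
proof (rule poly_ext)
  fix x
  show "poly (pderiv (A 1 * A (- 1))) x = poly [:0, 2:] x"
    using W_recD[OF assms(1), of "-1" x] assms(2) by (simp add: pderiv_mult algebra_simps)
qed

text \<open>Integrating the relations at n = -1 and n = -2 gives products of degree 2 and 3. The
  second contains \<open>A 1\<close> squared, so \<open>A 1\<close> cannot have degree 2.\<close>

lemma W_rec_degree:
  assumes "W_rec A" "A 0 = [:0, 1:]"
  shows "degree (A 1) + degree (A (- 1)) = 2" "degree (A 1) \<le> 1"
proof -
  have "degree (pderiv (A 1 * A (- 1))) = 1"
    by (simp add: W_rec_pderiv_1[OF assms])
  then have deg: "degree (A 1 * A (- 1)) = 2"
    by (simp add: degree_pderiv)
  then have "A 1 \<noteq> 0" "A (- 1) \<noteq> 0" by auto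
  with deg show "degree (A 1) + degree (A (- 1)) = 2"
    by (simp add: degree_mult_eq)
  \<comment> \<open>The relation for \<open>[L\<^sub>1, W\<^sub>-\<^sub>2]\<close> becomes exact after multiplication by \<open>A\<^sub>1\<close>.\<close>
  have "pderiv (A (-2) * (A 1)\<^sup>2) = smult 3 (A 1 * A (- 1))"
  proof (rule poly_ext)
    fix x
    have "2 * (poly (A (- 2)) x * poly (pderiv (A 1)) x) + poly (pderiv (A (- 2))) x * poly (A 1) x
        = 3 * poly (A (- 1)) x"
      using W_recD[OF assms(1), of "-2" x] by (simp add: algebra_simps)
    then show "poly (pderiv (A (-2) * (A 1)\<^sup>2)) x = poly (smult 3 (A 1 * A (- 1))) x"
      by (simp add: pderiv_mult pderiv_power_Suc power2_eq_square) algebra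
  qed
  then have "degree (pderiv (A (-2) * (A 1)\<^sup>2)) = 2"
    using deg by (metis degree_smult_eq zero_neq_numeral)
  then have deg3: "degree (A (-2) * (A 1)\<^sup>2) = 3"
    by (simp add: degree_pderiv)
  then have "A (-2) \<noteq> 0" by auto
  then have "degree (A (-2)) + 2 * degree (A 1) = 3"
    using deg3 \<open>A 1 \<noteq> 0\<close> by (simp add: degree_mult_eq degree_power_eq)
  then show "degree (A 1) \<le> 1" by simp
qed

text \<open>The relation at n = -2 determines \<open>A (- 2)\<close> up to the kernel of an Euler
  operator with k = 2, which is zero. For the reflected family this yields
  \<open>A 2\<close>.\<close>

lemma W_rec_minus_2:
  assumes "W_rec A" "A 1 = smult lam [:- \<alpha>, 1:]" "A (- 1) = smult (1 / lam) [:\<alpha>, 1:]" "lam \<noteq> 0"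
  shows "A (- 2) = smult (1 / lam\<^sup>2) [:2 * \<alpha>, 1:]"
proof -
  \<comment> \<open>Naming the inverse of \<open>lam\<^sup>2\<close> makes the goal polynomial
    modulo \<open>lam\<^sup>2 * c = 1\<close>, the form that \<open>algebra\<close> handles.\<close>
  define c where "c = 1 / lam\<^sup>2"
  let ?D = "A (- 2) - smult c [:2 * \<alpha>, 1:]"
  have c: "lam\<^sup>2 * c = 1"
    using assms(4) by (simp add: c_def)
  have D': "pderiv ?D = pderiv (A (- 2)) - [:c:]"
    by (simp add: pderiv_diff pderiv_smult pderiv_pCons)
  have "smult (lam\<^sup>2) (smult (of_nat 2) ?D + pderiv ?D * [:- \<alpha>, 1:]) = 0"
  proof (rule poly_ext)
    fix x
    have "lam\<^sup>2 * (2 * poly (A (- 2)) x + poly (pderiv (A (- 2))) x * (x - \<alpha>)) = 3 * (x + \<alpha>)"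
      using W_recD[OF assms(1), of "-2" x] assms(2-4)
      by (simp add: pderiv_smult pderiv_pCons field_simps power2_eq_square)
    then show "poly (smult (lam\<^sup>2) (smult (of_nat 2) ?D + pderiv ?D * [:- \<alpha>, 1:])) x = poly 0 x"
      unfolding D' poly_smult poly_add poly_diff poly_mult poly_pCons poly_0 of_nat_numeral
      using c by algebra
  qed
  then have "smult (of_nat 2) ?D + pderiv ?D * [:- \<alpha>, 1:] = 0"
    using assms(4) by (simp only: smult_eq_0_iff power_eq_0_iff simp_thms)
  then have "?D = 0"
    by (rule euler_operator_inj) simp
  then show ?thesis by (simp add: c_def)
qed

text \<open>At n = 1 the factor n - 1 vanishes and the recurrence says nothing about
  \<open>A 2\<close>, so induction starts from both \<open>A 1\<close> and \<open>A 2\<close>; for n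
  > 1 the factor cancels.\<close>

lemma W_rec_pos:
  assumes "W_rec A" "A 1 = smult lam [:- \<alpha>, 1:]" "A 2 = smult (lam\<^sup>2) [:- 2 * \<alpha>, 1:]" "n > 0"
  shows "A (int n) = smult (lam ^ n) [:- of_nat n * \<alpha>, 1:]"
  using \<open>n > 0\<close>
proof (induction n rule: nat_induct_non_zero)
  case 1
  show ?case using assms(2) by simp
next
  case (Suc n)
  show ?case
  proof (cases "n = 1")
    case True
    then show ?thesis using assms(3) by (simp add: numeral_2_eq_2)
  next
    case False
    have "smult (of_int (int n - 1)) (A (int (Suc n))) =
        smult (of_int (int n - 1)) (smult (lam ^ Suc n) [:- of_nat (Suc n) * \<alpha>, 1:])"
    proof (rule poly_ext)
      fix x
      show "poly (smult (of_int (int n - 1)) (A (int (Suc n)))) x =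
          poly (smult (of_int (int n - 1)) (smult (lam ^ Suc n) [:- of_nat (Suc n) * \<alpha>, 1:])) x"
        using W_recD[OF assms(1), of "int n" x, symmetric] Suc assms(2)
        by (simp add: pderiv_smult pderiv_pCons algebra_simps)
    qed
    then show ?thesis
      using False by (metis (no_types, lifting) diff_eq_eq add.left_neutral eq_iff_diff_eq_0 of_int_eq_0_iff of_nat_1
          of_nat_eq_iff smult_eq_iff)
  qed
qed

lemma W_rec_solution:
  assumes A: "W_rec A" and B: "W_rec (\<lambda>n. A (- n))" and A0: "A 0 = [:0, 1:]"
  obtains lam \<alpha> where "lam \<noteq> 0" "\<And>n. A n = smult (lam powi n) [:- (of_int n * \<alpha>), 1:]"
proof -
  have "degree (A 1) = 1" "degree (A (- 1)) = 1"
    using W_rec_degree[OF A A0] W_rec_degree[OF B] A0 by simp_all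
  moreover have "\<exists>l a. l \<noteq> 0 \<and> p = smult l [:- a, 1:]" if p: "degree p = 1" for p :: "complex poly"
  proof -
    obtain c d where "p = [:c, d:]" "d \<noteq> 0"
      using p degree1_coeffs[of p] by metis
    then show ?thesis by (intro exI[of _ d] exI[of _ "- c / d"]) simp
  qed
  ultimately obtain l a l' a' where l: "l \<noteq> 0" "A 1 = smult l [:- a, 1:]" "A (- 1) = smult l' [:- a', 1:]"
    by metis
  \<comment> \<open>These are the coefficients of
    \<open>pderiv (A 1 * A (- 1)) = [:0, 2:]\<close>.\<close>
  have "l * l' = 1 \<and> l * l' * (- a' - a) = 0"
    using W_rec_pderiv_1[OF A A0] unfolding l(2,3) pderiv_mult
    by (auto simp: pderiv_smult pderiv_pCons algebra_simps)
  then have "l * l' = 1" "a' = - a" by (auto simp: add_eq_0_iff)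
  then have A': "A (- 1) = smult (1 / l) [:a, 1:]"
    using l by (simp add: field_simps add_eq_0_iff)
  have m: "A (- 2) = smult (1 / l\<^sup>2) [:2 * a, 1:]"
    by (rule W_rec_minus_2[OF A l(2) A' l(1)])
  \<comment> \<open>Reflection n to -n replaces the parameters l and a by 1/l and -a.\<close>
  have p: "A 2 = smult (l\<^sup>2) [:- 2 * a, 1:]"
    using W_rec_minus_2[OF B, of "1 / l" "- a"] A' l by (simp add: power_divide)
  have pos: "A (int n) = smult (l ^ n) [:- of_nat n * a, 1:]" if "n > 0" for n
    by (rule W_rec_pos[OF A l(2) p that])
  have neg: "A (- int n) = smult ((1 / l) ^ n) [:of_nat n * a, 1:]" if "n > 0" for n
    using W_rec_pos[OF B _ _ that, of "1 / l" "- a"] A' m l(1) by (simp add: power_divide)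
  show thesis
  proof (rule that[OF l(1)])
    fix n :: int
    consider "n = 0" | "n > 0" | "n < 0" by linarith
    then show "A n = smult (l powi n) [:- (of_int n * a), 1:]"
    proof cases
      case 1
      then show ?thesis using A0 by simp
    next
      case 2
      then show ?thesis using pos[of "nat n"] by (simp add: power_int_def)
    next
      case 3
      then show ?thesis using neg[of "nat (- n)"] by (simp add: power_int_def field_simps)
    qed
  qed
qed

section \<open>The recurrence for the action of the L_n\<close>

text \<open>
  The condition that \<open>[L\<^sub>1, L\<^sub>n] = (n - 1) L\<^sub>n\<^sub>+\<^sub>1\<close> imposes on \<open>F\<^sub>n\<close>, where \<open>L\<^sub>n \<cdot> 1 = \<lambda>\<^sup>n (s + F\<^sub>n)\<close>;
  for \<open>L\<^sub>-\<^sub>1\<close> replace \<open>F\<^sub>n\<close> by \<open>F\<^sub>-\<^sub>n\<close> and \<open>\<alpha>\<close> by \<open>- \<alpha>\<close>.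
\<close>

definition L_rec :: "complex \<Rightarrow> (int \<Rightarrow> complex poly) \<Rightarrow> bool" where
  "L_rec \<alpha> F \<longleftrightarrow> (\<forall>n. smult (of_int n) (F n) - F 1 - pderiv (F n) * [:- \<alpha>, 1:]
     + smult (of_int n) (pderiv (F 1) * [:- (of_int n * \<alpha>), 1:]) = smult (of_int (n - 1)) (F (n + 1)))"

lemma L_rec_diff: "L_rec \<alpha> F \<Longrightarrow> L_rec \<alpha> G \<Longrightarrow> L_rec \<alpha> (\<lambda>n. F n - G n)"
  unfolding L_rec_def
proof (intro allI)
  fix n
  let ?E = "\<lambda>F. smult (of_int n) (F n) - F 1 - pderiv (F n) * [:- \<alpha>, 1:]
     + smult (of_int n) (pderiv (F 1) * [:- (of_int n * \<alpha>), 1:])"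
  assume "\<forall>n. smult (of_int n) (F n) - F 1 - pderiv (F n) * [:- \<alpha>, 1:]
     + smult (of_int n) (pderiv (F 1) * [:- (of_int n * \<alpha>), 1:]) = smult (of_int (n - 1)) (F (n + 1))"
   "\<forall>n. smult (of_int n) (G n) - G 1 - pderiv (G n) * [:- \<alpha>, 1:]
     + smult (of_int n) (pderiv (G 1) * [:- (of_int n * \<alpha>), 1:]) = smult (of_int (n - 1)) (G (n + 1))"
  then have "?E F = smult (of_int (n - 1)) (F (n + 1))" "?E G = smult (of_int (n - 1)) (G (n + 1))"
    by blast+
  moreover have "?E (\<lambda>n. F n - G n) = ?E F - ?E G"
    by (simp add: pderiv_diff left_diff_distrib smult_diff_right del: mult_pCons_right)
  ultimately show "?E (\<lambda>n. F n - G n) = smult (of_int (n - 1)) (F (n + 1) - G (n + 1))"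
    by (simp only: smult_diff_right)
qed

text \<open>With \<open>F 1 = 0\<close> the relations at n = -1 and n = -2 equate an Euler operator,
  with k = 1 and k = 2, to a multiple of the next value, which is already zero.\<close>

lemma L_rec_minus_zero:
  assumes "L_rec \<alpha> F" "F 1 = 0" "F 0 = 0"
  shows "F (- 1) = 0" "F (- 2) = 0"
proof -
  have *: "smult (of_int n) (F n) - pderiv (F n) * [:- \<alpha>, 1:] = smult (of_int (n - 1)) (F (n + 1))" for n
    using assms unfolding L_rec_def by simp
  have "smult (of_nat 1) (F (-1)) + pderiv (F (-1)) * [:- \<alpha>, 1:] = 0"
    using *[of "-1"] assms(3) by (simp add: add_eq_0_iff del: mult_pCons_right)
  then show m1: "F (- 1) = 0" by (rule euler_operator_inj) simp
  have "smult (of_nat 2) (F (-2)) + pderiv (F (-2)) * [:- \<alpha>, 1:] = 0"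
    using *[of "-2"] m1 by (simp add: add_eq_0_iff del: mult_pCons_right)
  then show "F (- 2) = 0" by (rule euler_operator_inj) simp
qed

lemma L_rec_pos:
  assumes "L_rec \<alpha> F" "F 1 = 0" "F 2 = 0" "n > 0"
  shows "F (int n) = 0"
  using \<open>n > 0\<close>
proof (induction n rule: nat_induct_non_zero)
  case 1
  show ?case using assms(2) by simp
next
  case (Suc n)
  have "smult (of_int (int n - 1)) (F (int n + 1)) = 0"
    using assms(1,2) Suc unfolding L_rec_def by (metis (no_types, lifting) diff_zero
        add.right_neutral mult_zero_left pderiv_0 smult_0_right)
  then show ?case
    using Suc assms(3) by (cases "n = 1") (simp_all add: add.commute)
qed

text \<open>The values at 0 and 1 kill those at -1 and -2. The reflected recurrence then kills
  \<open>F 2\<close>, which the first one leaves free, and both directions propagate.\<close>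

lemma L_rec_zero:
  assumes "L_rec \<alpha> F" "L_rec (- \<alpha>) (\<lambda>n. F (- n))" "F 0 = 0" "F 1 = 0"
  shows "F n = 0"
proof -
  have m: "F (- 1) = 0" "F (- 2) = 0"
    using L_rec_minus_zero[OF assms(1,4,3)] by simp_all
  have "F 2 = 0"
    using L_rec_minus_zero[OF assms(2)] m assms(3) by simp
  then have "F (int n) = 0" "F (- int n) = 0" if "n > 0" for n
    using L_rec_pos[OF assms(1,4) _ that] L_rec_pos[OF assms(2) _ _ that] m by simp_all
  then show ?thesis
    using assms(3) by (metis int_cases2 neg_0_equal_iff_equal not_gr_zero of_nat_0)
qed

section \<open>Closed form of the families in \<open>H_family\<close>\<close>

lemma smult_sum_right: "smult c (\<Sum>i\<in>I. f i) = (\<Sum>i\<in>I. smult c (f i))"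
  using sum_distrib_left[of "[:c:]" f I] by simp

text \<open>Dividing \<open>f = h\<^sub>1\<close> by \<open>t - \<alpha>\<close> gives \<open>f = \<kappa> + (t - \<alpha>) G\<close>, and the quotients in \<open>h_poly\<close> add up to \<open>G\<close>.\<close>

lemma H_family_normal_form:
  obtains h \<kappa> G where "h \<in> H_family \<alpha>" "h 1 = f"
    "\<And>n. h n = smult (of_int n) ([:\<kappa>:] + [:- (of_int n * \<alpha>), 1:] * G)"
proof -
  define S :: "nat \<Rightarrow> complex poly" where "S k = (\<Sum>j<k. monom (\<alpha> ^ (k - 1 - j)) j)" for k
  \<comment> \<open>Since \<open>h_poly \<alpha> 1 i = monom 1 i\<close>, the value at n = 1 forces
    the coefficients of \<open>f\<close>.\<close>
  define \<xi> where "\<xi> = coeff f"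
  define I where "I = {i. \<xi> i \<noteq> 0}"
  define h where "h n = (\<Sum>i\<in>I. smult (\<xi> i) (h_poly \<alpha> n i))" for n
  define G where "G = (\<Sum>i\<in>I. smult (\<xi> i) (S i))"
  have fin: "finite I"
    unfolding I_def \<xi>_def using MOST_coeff_eq_0[of f] by (simp add: eventually_cofinite)
  have f: "f = (\<Sum>i\<in>I. smult (\<xi> i) (monom 1 i))"
  proof (rule poly_eqI)
    fix k
    have "(\<Sum>i\<in>I. coeff (smult (\<xi> i) (monom 1 i)) k) = (\<Sum>i\<in>I. if i = k then \<xi> k else 0)"
      by (rule sum.cong) auto
    also have "\<dots> = coeff f k"
      using fin by (simp add: I_def \<xi>_def)
    finally show "coeff f k = coeff (\<Sum>i\<in>I. smult (\<xi> i) (monom 1 i)) k"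
      by (simp add: coeff_sum)
  qed
  have h: "h n = smult (of_int n) f - smult (of_int (n * (n - 1)) * \<alpha>) G" for n
  proof -
    have "h n = (\<Sum>i\<in>I. smult (of_int n) (smult (\<xi> i) (monom 1 i))
        - smult (of_int (n * (n - 1)) * \<alpha>) (smult (\<xi> i) (S i)))"
      unfolding h_def h_poly_def S_def[symmetric]
      by (rule sum.cong) (simp_all add: smult_diff_right mult_ac)
    then show ?thesis
      by (subst f) (simp add: G_def sum_subtractf smult_sum_right)
  qed
  have "G * [:- \<alpha>, 1:] = (\<Sum>i\<in>I. smult (\<xi> i) (monom 1 i - [:\<alpha> ^ i:]))"
    by (simp only: G_def sum_distrib_right[of _ I] mult_smult_left S_def h_poly_quotient)
  also have "\<dots> = f - [:\<Sum>i\<in>I. \<xi> i * \<alpha> ^ i:]"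
    by (subst f) (simp add: smult_diff_right sum_subtractf sum_to_poly)
  finally have G: "[:- \<alpha>, 1:] * G = f - [:\<Sum>i\<in>I. \<xi> i * \<alpha> ^ i:]"
    by (simp only: mult.commute)
  show thesis
  proof (rule that)
    show "h \<in> H_family \<alpha>"
      unfolding H_family_def h_def I_def using fin[unfolded I_def] by blast
    show "h 1 = f" by (simp add: h)
    fix n
    show "h n = smult (of_int n) ([:\<Sum>i\<in>I. \<xi> i * \<alpha> ^ i:] + [:- (of_int n * \<alpha>), 1:] * G)"
    proof (rule poly_ext)
      fix x
      \<comment> \<open>Substituting this for \<open>f\<close> works because (x - \<alpha>) - (n -
        1) \<alpha> = x - n \<alpha>.\<close>
      have "(x - \<alpha>) * poly G x = poly f x - (\<Sum>i\<in>I. \<xi> i * \<alpha> ^ i)"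
        using arg_cong[OF G, of "\<lambda>p. poly p x"] by (simp add: algebra_simps)
      then show "poly (h n) x = poly (smult (of_int n) ([:\<Sum>i\<in>I. \<xi> i * \<alpha> ^ i:] + [:- (of_int n * \<alpha>), 1:] * G)) x"
        unfolding h by simp algebra
    qed
  qed
qed

text \<open>At a point this is a polynomial identity in x, \<alpha>, \<kappa> and the values of G
  and G'. It holds for all m and n, hence also where the cocycle does not vanish.\<close>

lemma L_relation_normal_form:
  fixes m n :: int and \<alpha> \<kappa> :: complex and G :: "complex poly"
  defines "h \<equiv> \<lambda>n. smult (of_int n) ([:\<kappa>:] + [:- (of_int n * \<alpha>), 1:] * G)"
  shows "smult (of_int n) (h n) - smult (of_int m) (h m)
     - smult (of_int m) (pderiv (h n) * [:- (of_int m * \<alpha>), 1:])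
     + smult (of_int n) (pderiv (h m) * [:- (of_int n * \<alpha>), 1:]) = smult (of_int (n - m)) (h (m + n))"
proof (rule poly_ext)
  fix x
  have h: "poly (h k) x = of_int k * (\<kappa> + (x - of_int k * \<alpha>) * poly G x)" for k
    by (simp add: h_def algebra_simps)
  have h': "poly (pderiv (h k)) x = of_int k * (poly G x + (x - of_int k * \<alpha>) * poly (pderiv G) x)" for k
    by (simp add: h_def pderiv_smult pderiv_add pderiv_mult pderiv_pCons algebra_simps
        del: mult_pCons_left mult_pCons_right add_pCons)
  show "poly (smult (of_int n) (h n) - smult (of_int m) (h m)
     - smult (of_int m) (pderiv (h n) * [:- (of_int m * \<alpha>), 1:])
     + smult (of_int n) (pderiv (h m) * [:- (of_int n * \<alpha>), 1:])) x = poly (smult (of_int (n - m)) (h (m + n))) x"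
    unfolding poly_smult poly_add poly_diff poly_mult poly_pCons poly_0 h h' of_int_diff of_int_add
    by algebra
qed

section \<open>Modules in which \<open>L\<^sub>0\<close> and \<open>W\<^sub>0\<close> are the multiplications by \<open>s\<close> and \<open>t\<close>\<close>

lemma poly2_induct [case_names one smult add mult_s mult_t]:
  fixes f :: "complex poly poly"
  assumes one: "P 1"
    and smult: "\<And>c f. P f \<Longrightarrow> P (poly2_scale c f)"
    and add: "\<And>f g. P f \<Longrightarrow> P g \<Longrightarrow> P (f + g)"
    and mult_s: "\<And>f. P f \<Longrightarrow> P ([:0, 1:] * f)"
    and mult_t: "\<And>f. P f \<Longrightarrow> P ([:[:0, 1:]:] * f)"
  shows "P f"
proof -
  have 0: "P 0" using smult[OF one, of 0] by (simp add: poly2_scale_def)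
  have const: "P [:p:]" for p
  proof (induction p)
    case (pCons c p)
    have "[:pCons c p:] = poly2_scale c 1 + [:[:0, 1:]:] * [:p:]"
      by (simp add: poly2_scale_def one_pCons)
    then show ?case using pCons one smult add mult_t by metis
  qed (simp add: 0)
  show ?thesis
  proof (induction f)
    case (pCons p f)
    have "pCons p f = [:p:] + [:0, 1:] * f" by simp
    then show ?case using pCons const add mult_s by metis
  qed (rule 0)
qed

lemma shift_s_simps [simp]:
  "shift_s m 1 = 1" "shift_s m [:p:] = [:p:]" "shift_s m 0 = 0"
  "shift_s m (f + g) = shift_s m f + shift_s m g"
  "shift_s m (f * g) = shift_s m f * shift_s m g"
  "shift_s m (poly2_scale c f) = poly2_scale c (shift_s m f)"
  "shift_s m [:p, q:] = [:p - of_int m * q, q:]"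
  by (simp_all add: shift_s_def poly2_scale_def pcompose_add pcompose_mult pcompose_smult
      pcompose_pCons one_pCons del: mult_pCons_right)

lemma deriv_t_simps [simp]:
  "deriv_t 1 = 0" "deriv_t [:p:] = [:pderiv p:]" "deriv_t [:p, q:] = [:pderiv p, pderiv q:]"
  "deriv_t (f + g) = deriv_t f + deriv_t g"
  "deriv_t (poly2_scale c f) = poly2_scale c (deriv_t f)"
  by (simp_all add: poly_eq_iff coeff_deriv_t poly2_scale_def pderiv_add pderiv_smult coeff_pCons one_pCons
      split: nat.splits)

lemma deriv_t_mult_const: "deriv_t ([:p:] * f) = [:p:] * deriv_t f + [:pderiv p:] * f"
  by (simp add: poly_eq_iff[of "deriv_t _"] coeff_deriv_t pderiv_mult mult.commute)

lemma deriv_t_mult_s: "deriv_t ([:- of_int m, 1:] * f) = [:- of_int m, 1:] * deriv_t f"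
proof -
  have "pderiv (of_int m :: complex poly) = 0" by (simp add: of_int_poly)
  then show ?thesis
    by (simp add: poly_eq_iff[of "deriv_t _"] coeff_deriv_t pderiv_mult coeff_pCons pderiv_diff
        split: nat.splits)
qed

lemma poly2_scale_mult: "poly2_scale c f * g = poly2_scale c (f * g)" "f * poly2_scale c g = poly2_scale c (f * g)"
  by (simp_all add: poly2_scale_def)

text \<open>\<open>T\<close> commutes with t and moves past s at the cost of s becoming s - n. As 1
  generates under s and t, \<open>T\<close> is determined by its value at 1.\<close>

lemma weight_operator:
  fixes T :: "complex poly poly \<Rightarrow> complex poly poly"
  assumes "\<And>f g. T (f + g) = T f + T g" "\<And>c f. T (poly2_scale c f) = poly2_scale c (T f)"
    and "\<And>f. T ([:0, 1:] * f) = [:- of_int n, 1:] * T f" "\<And>f. T ([:[:0, 1:]:] * f) = [:[:0, 1:]:] * T f"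
  shows "T f = shift_s n f * T 1"
  by (induction f rule: poly2_induct)
    (simp_all only: assms shift_s_simps distrib_right mult.assoc mult_1 diff_0 mult_1_right
      poly2_scale_mult)

lemma poly2_scale_const: "poly2_scale c [:p:] = [:smult c p:]" "poly2_scale c [:p, q:] = [:smult c p, smult c q:]"
  by (simp_all add: poly2_scale_def)

lemma shift_s_shift_s: "shift_s m (shift_s n f) = shift_s (m + n) f"
  by (simp add: shift_s_def flip: pcompose_assoc) (simp add: pcompose_pCons algebra_simps)

lemma degree_shift_s [simp]: "degree (shift_s m f) = degree f"
  by (simp add: shift_s_def degree_pcompose)

lemma shift_s_invariant_imp_const:
  assumes "shift_s n f = f" "n \<noteq> 0"
  shows "f = [:coeff f 0:]"
proof -
  have "degree f = 0"
    using shift_invariant_imp_degree_0[of f "- of_int n"] assms by (simp add: shift_s_def)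
  then show ?thesis by (metis degree_eq_zeroE coeff_pCons_0)
qed

text \<open>\<open>[:0, g:]\<close>, that is g s, solves the same difference equation, and the
  difference of two solutions is shift invariant, hence free of s.\<close>

lemma shift_s_difference_const:
  assumes "f - shift_s n f = [:of_int n * g:]" "n \<noteq> 0"
  shows "f = [:coeff f 0, g:]"
proof -
  have "shift_s n [:0, - g:] = [:0, - g:] + [:of_int n * g:]"
    by simp
  then have "shift_s n (f + [:0, - g:]) = f + [:0, - g:]"
    unfolding assms(1)[symmetric] shift_s_simps(4) by (simp only: algebra_simps)
  then have "f + [:0, - g:] = [:coeff (f + [:0, - g:]) 0:]"
    using assms(2) by (rule shift_s_invariant_imp_const)
  then have "f = [:coeff (f + [:0, - g:]) 0:] - [:0, - g:]"
    unfolding eq_diff_eq .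
  also have "\<dots> = [:coeff f 0, g:]"
    by simp
  finally show ?thesis .
qed

section \<open>The action expressed through its values at 1\<close>

locale cartan_free_module = lie_module poly2_scale rep
  for rep :: "w22 \<Rightarrow> complex poly poly \<Rightarrow> complex poly poly" +
  assumes rep_L0: "rep (w22_L 0) f = [:0, 1:] * f"
    and rep_W0: "rep (w22_W 0) f = [:[:0, 1:]:] * f"
begin

lemma rep_add_right: "rep x (f + g) = rep x f + rep x g"
proof -
  interpret Vector_Spaces.linear poly2_scale poly2_scale "rep x" by (rule rep_linear)
  show ?thesis by (rule add)
qed

lemma rep_scale_right: "rep x (poly2_scale c f) = poly2_scale c (rep x f)"
proof -
  interpret Vector_Spaces.linear poly2_scale poly2_scale "rep x" by (rule rep_linear)
  show ?thesis by (rule scale)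
qed

definition a where "a n = rep (w22_W n) 1"
definition b where "b n = rep (w22_L n) 1"

lemma bracket_L_L: "rep (w22_L m) (rep (w22_L n) f) - rep (w22_L n) (rep (w22_L m) f) =
    poly2_scale (of_int (n - m)) (rep (w22_L (m + n)) f) + poly2_scale (w22_cocycle m n) (rep w22_C1 f)"
  unfolding rep_bracket[symmetric] bracket_w22_L_L rep_add rep_scaleL w22_cocycle_def ..

lemma bracket_L_W: "rep (w22_L m) (rep (w22_W n) f) - rep (w22_W n) (rep (w22_L m) f) =
    poly2_scale (of_int (n - m)) (rep (w22_W (m + n)) f) + poly2_scale (w22_cocycle m n) (rep w22_C2 f)"
  unfolding rep_bracket[symmetric] bracket_w22_L_W rep_add rep_scaleL w22_cocycle_def ..

lemma rep_zero: "rep 0 f = 0"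
  using rep_scaleL[of 0 0 f] by simp

lemma bracket_W_W: "rep (w22_W m) (rep (w22_W n) f) = rep (w22_W n) (rep (w22_W m) f)"
  using rep_bracket[of "w22_W m" "w22_W n" f] by (simp add: bracket_w22_W_W rep_zero)

lemma rep_central:
  assumes "z \<in> {w22_C1, w22_C2}"
  shows "rep z (rep x f) = rep x (rep z f)"
proof -
  have "bracket z x = 0" using assms bracket_w22_central by auto
  then show ?thesis using rep_bracket[of z x f] by (simp add: rep_zero)
qed

lemma cocycle_0 [simp]: "w22_cocycle 0 n = 0" "w22_cocycle n 0 = 0"
    "w22_cocycle 1 n = 0" "w22_cocycle n 1 = 0" "w22_cocycle (- 1) n = 0" "w22_cocycle n (- 1) = 0"
proof -
  have "n ^ 3 = n" if "n = 1 \<or> n = - 1 \<or> n = 0" for n :: int using that by auto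
  moreover have "n + 1 = 0 \<longleftrightarrow> n = - 1" "n - 1 = 0 \<longleftrightarrow> n = 1" "1 + n = 0 \<longleftrightarrow> n = - 1" "- 1 + n = 0 \<longleftrightarrow> n = 1" by auto
  ultimately show "w22_cocycle 0 n = 0" "w22_cocycle n 0 = 0"
    "w22_cocycle 1 n = 0" "w22_cocycle n 1 = 0" "w22_cocycle (- 1) n = 0" "w22_cocycle n (- 1) = 0"
    by (auto simp: w22_cocycle_def)
qed

lemma rep_weight_s:
  assumes "bracket (w22_L 0) x = of_int n *\<^sub>C x"
  shows "rep x ([:0, 1:] * f) = [:- of_int n, 1:] * rep x f"
proof -
  have "[:0, 1:] * rep x f - rep x ([:0, 1:] * f) = poly2_scale (of_int n) (rep x f)"
    using rep_bracket[of "w22_L 0" x f] by (simp only: assms rep_scaleL rep_L0)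
  then have "rep x ([:0, 1:] * f) = [:0, 1:] * rep x f - [:[:of_int n:]:] * rep x f"
    by (simp add: poly2_scale_def algebra_simps)
  also have "\<dots> = [:- of_int n, 1:] * rep x f"
    unfolding left_diff_distrib[symmetric] by (simp add: of_int_poly)
  finally show ?thesis .
qed

lemma bracket_L0: "bracket (w22_L 0) (w22_L n) = of_int n *\<^sub>C w22_L n"
  "bracket (w22_L 0) (w22_W n) = of_int n *\<^sub>C w22_W n"
  by (simp_all add: bracket_w22_L_L bracket_w22_L_W)

lemma rep_W: "rep (w22_W n) f = shift_s n f * a n"
  unfolding a_def
  by (rule weight_operator)
    (simp_all only: rep_add_right rep_scale_right rep_weight_s[OF bracket_L0(2)] bracket_W_W[of n 0] rep_W0[symmetric])

lemma rep_L: "rep (w22_L n) f = shift_s n f * b n - poly2_scale (of_int n) (deriv_t (shift_s n f) * a n)"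
proof -
  \<comment> \<open>\<open>[L_n, W_0] = - n W_n\<close> keeps L_n from commuting with t. The
    derivative term cancels this defect, so \<open>weight_operator\<close> applies to
    \<open>T\<close>.\<close>
  define T where "T f = rep (w22_L n) f + poly2_scale (of_int n) (deriv_t (shift_s n f) * a n)" for f
  have "T f = shift_s n f * T 1"
  proof (rule weight_operator)
    fix f g c
    show "T (f + g) = T f + T g"
      by (simp add: T_def rep_add_right distrib_right scale_right_distrib)
    show "T (poly2_scale c f) = poly2_scale c (T f)"
      by (simp add: T_def rep_scale_right scale_right_distrib mult.commute) (simp add: poly2_scale_def mult.commute)
    have "shift_s n [:0, 1:] = [:- of_int n, 1:]" by simp
    then show "T ([:0, 1:] * f) = [:- of_int n, 1:] * T f"
      unfolding T_def rep_weight_s[OF bracket_L0(1)] shift_s_simps(5)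
      by (simp only: deriv_t_mult_s distrib_left poly2_scale_mult mult.assoc)
    have "rep (w22_L n) ([:[:0, 1:]:] * f) - [:[:0, 1:]:] * rep (w22_L n) f = poly2_scale (of_int (- n)) (rep (w22_W n) f)"
      using bracket_L_W[of n 0 f] by (simp add: rep_W0 del: mult_pCons_left)
    then have "rep (w22_L n) ([:[:0, 1:]:] * f) = [:[:0, 1:]:] * rep (w22_L n) f - poly2_scale (of_int n) (rep (w22_W n) f)"
      by (simp add: algebra_simps)
    then show "T ([:[:0, 1:]:] * f) = [:[:0, 1:]:] * T f"
      unfolding T_def shift_s_simps(2,5) deriv_t_mult_const
      by (simp add: rep_W poly2_scale_mult distrib_left distrib_right mult.assoc scale_right_distrib pderiv_pCons
          flip: one_pCons del: mult_pCons_left)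
  qed
  then show ?thesis
    by (simp add: T_def b_def algebra_simps)
qed

lemma rep_C:
  assumes "z \<in> {w22_C1, w22_C2}"
  shows "rep z f = f * rep z 1"
proof -
  have "rep z f = shift_s 0 f * rep z 1"
    by (rule weight_operator)
      (simp_all add: rep_add_right rep_scale_right rep_L0[symmetric] rep_W0[symmetric] rep_central[OF assms]
        del: mult_pCons_left)
  then show ?thesis by (simp add: shift_s_def pcompose_idR)
qed

section \<open>The polynomials \<open>a n\<close> and the brackets of L with W\<close>

definition A where "A n = coeff (a n) 0"

lemma a_0: "a 0 = [:[:0, 1:]:]"
  by (simp add: a_def rep_W0)

lemma b_0: "b 0 = [:0, 1:]"
  by (simp add: b_def rep_L0)

text \<open>If W_e acted by zero, so would [L_{-e}, W_e] = 2e W_0, whose central term vanishes for e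
  = 1 and e = -1; but W_0 is multiplication by t.\<close>

lemma a_unit_nonzero:
  assumes "e \<in> {1, - 1}"
  shows "a e \<noteq> 0"
proof
  assume "a e = 0"
  then have "rep (w22_W e) f = 0" for f by (simp add: rep_W)
  then have "poly2_scale (of_int (2 * e)) (a 0) = 0"
    using assms bracket_L_W[of "- e" e 1] rep_L[of "-e" 0] deriv_t_simps(2)[of 0] by (auto simp: a_def)
  then show False
    using assms by (auto simp: a_0 poly2_scale_def)
qed

lemma a_commute: "shift_s m (a n) * a m = shift_s n (a m) * a n"
  using bracket_W_W[of m n 1] by (simp add: rep_W)

text \<open>The commutation of W_1 and W_{-1} is the shift invariance of \<open>?w\<close>. A factor
  of a nonzero product free of s is itself free of s.\<close>

lemma degree_a_unit: "degree (a 1) = 0"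
proof -
  let ?w = "a 1 * shift_s 1 (a (- 1))"
  have "shift_s (- 1) ?w = shift_s (- 1) (a 1) * a (- 1)"
    by (simp add: shift_s_shift_s) (simp add: shift_s_def pcompose_idR)
  also have "\<dots> = ?w"
    using a_commute[of 1 "- 1"] by (simp add: mult.commute)
  finally have "degree ?w = 0"
    using shift_s_invariant_imp_const by (metis degree_pCons_0 neg_equal_0_iff_equal zero_neq_one)
  moreover have "shift_s 1 (a (- 1)) \<noteq> 0"
    using a_unit_nonzero[of "- 1"] by (simp add: shift_s_def pcompose_eq_0_iff)
  ultimately show ?thesis
    using a_unit_nonzero[of 1] by (simp add: degree_mult_eq)
qed

text \<open>Since \<open>a 1\<close> is free of s, it cancels from the commutation relation with
  W_1, leaving shift invariance of \<open>a n\<close>.\<close>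

lemma a_const: "a n = [:A n:]"
proof -
  have "shift_s n (a 1) = a 1"
    using degree_a_unit by (metis degree_eq_zeroE shift_s_simps(2))
  then have "shift_s 1 (a n) = a n"
    using a_commute[of 1 n] a_unit_nonzero[of 1] by (simp add: mult.commute)
  then show ?thesis
    unfolding A_def by (rule shift_s_invariant_imp_const) simp
qed

text \<open>This is [L_m, W_n] applied to 1. The central term stays, because C_2 is not yet known to
  act by zero.\<close>

lemma relation_L_W: "(b m - shift_s n (b m)) * [:A n:] =
    [:smult (of_int m) (pderiv (A n) * A m) + smult (of_int (n - m)) (A (m + n)):]
      + poly2_scale (w22_cocycle m n) (rep w22_C2 1)"
proof -
  have "rep (w22_L m) [:A n:] - rep (w22_W n) (b m) =
      poly2_scale (of_int (n - m)) [:A (m + n):] + poly2_scale (w22_cocycle m n) (rep w22_C2 1)"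
    using bracket_L_W[of m n 1] by (simp only: a_def[symmetric] b_def[symmetric] a_const)
  then have "[:A n:] * b m - poly2_scale (of_int m) ([:pderiv (A n):] * [:A m:]) - shift_s n (b m) * [:A n:] =
      poly2_scale (of_int (n - m)) [:A (m + n):] + poly2_scale (w22_cocycle m n) (rep w22_C2 1)"
    by (simp only: rep_L rep_W shift_s_simps deriv_t_simps a_const)
  moreover have "poly2_scale (of_int m) ([:pderiv (A n):] * [:A m:]) = [:smult (of_int m) (pderiv (A n) * A m):]"
    by (simp add: poly2_scale_const mult.commute)
  ultimately show ?thesis
    by (simp add: poly2_scale_const algebra_simps del: mult_pCons_left mult_pCons_right)
qed

text \<open>For m = n = e both the factor n - m and the cocycle vanish; cancelling
  \<open>A e\<close> leaves a difference equation for \<open>b e\<close>.\<close>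

lemma b_unit:
  assumes "e \<in> {1, - 1}"
  shows "b e = [:coeff (b e) 0, pderiv (A e):]"
proof (rule shift_s_difference_const[where n = e])
  have "(b e - shift_s e (b e)) * [:A e:] = [:of_int e * pderiv (A e):] * [:A e:]"
    using relation_L_W[of e e] assms by (auto simp del: mult_pCons_left)
  then show "b e - shift_s e (b e) = [:of_int e * pderiv (A e):]"
    using a_unit_nonzero[OF assms] by (simp only: a_const mult_cancel_right) simp
qed (use assms in auto)

text \<open>By \<open>b_unit\<close>, shifting \<open>b e\<close> by n subtracts n times the
  derivative of \<open>A e\<close>. Inserted into \<open>relation_L_W\<close>, e = 1 gives the first
  recurrence and e = -1 the reflected one.\<close>

lemma W_rec_A: "W_rec A" "W_rec (\<lambda>n. A (- n))"
proof -
  have *: "smult (of_int n) (pderiv (A e) * A n) =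
      smult (of_int e) (pderiv (A n) * A e) + smult (of_int (n - e)) (A (e + n))" if "e \<in> {1, - 1}" for e n
  proof -
    have "b e - shift_s n (b e) = [:smult (of_int n) (pderiv (A e)):]"
      by (subst (1 2) b_unit[OF that]) (simp add: of_int_poly)
    then show ?thesis
      using relation_L_W[of e n] that by (auto simp: mult.commute)
  qed
  show "W_rec A" "W_rec (\<lambda>n. A (- n))"
    unfolding W_rec_def
  proof (safe intro!: poly_ext)
    fix n x
    show "poly (smult (of_int n) (A n * pderiv (A 1)) - pderiv (A n) * A 1) x =
        poly (smult (of_int (n - 1)) (A (n + 1))) x"
      using arg_cong[OF *[of 1 n], of "\<lambda>p. poly p x"] by (simp add: algebra_simps)
    show "poly (smult (of_int n) (A (- n) * pderiv (A (- 1))) - pderiv (A (- n)) * A (- 1)) x =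
        poly (smult (of_int (n - 1)) (A (- (n + 1)))) x"
      using arg_cong[OF *[of "- 1" "- n"], of "\<lambda>p. poly p x"] by (simp add: algebra_simps)
  qed
qed

section \<open>The polynomials \<open>b n\<close> and the central elements\<close>

text \<open>[L_m, W_1] has no central term, and its right-hand side is \<open>lam powi m\<close>
  times \<open>A 1\<close>, which cancels.\<close>

lemma b_normal_form:
  assumes A: "\<And>n. A n = smult (lam powi n) [:- (of_int n * \<alpha>), 1:]" and "lam \<noteq> 0"
  shows "b m = [:coeff (b m) 0, [:lam powi m:]:]"
proof (rule shift_s_difference_const[where n = 1])
  have "smult (of_int m) (pderiv (A 1) * A m) + smult (of_int (1 - m)) (A (m + 1)) = [:lam powi m:] * A 1"
    using \<open>lam \<noteq> 0\<close> unfolding A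
    by (simp add: pderiv_smult pderiv_pCons power_int_add algebra_simps)
  then have "(b m - shift_s 1 (b m)) * [:A 1:] = [:[:lam powi m:]:] * [:A 1:]"
    using relation_L_W[of m 1] by simp
  then show "b m - shift_s 1 (b m) = [:of_int 1 * [:lam powi m:]:]"
    using a_unit_nonzero[of 1] by (simp only: a_const mult_cancel_right) simp
qed simp

text \<open>The remaining terms of [L_2, W_{-2}] balance, while the cocycle at (2, -2) is 6/12, so
  C_2 kills 1.\<close>

lemma rep_C2_zero:
  assumes A: "\<And>n. A n = smult (lam powi n) [:- (of_int n * \<alpha>), 1:]" and "lam \<noteq> 0"
  shows "rep w22_C2 f = 0"
proof -
  have "b 2 - shift_s (- 2) (b 2) = [:[:- 2 * lam powi 2:]:]"
    by (subst (1 2) b_normal_form[OF assms]) (simp add: of_int_poly)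
  moreover have "[:[:- 2 * lam powi 2:]:] * [:A (- 2):] =
      [:smult (of_int 2) (pderiv (A (- 2)) * A 2) + smult (of_int (- 2 - 2)) (A (2 + - 2)):]"
    using \<open>lam \<noteq> 0\<close> unfolding A
    by (simp add: pderiv_smult pderiv_pCons power_int_minus)
  ultimately have "poly2_scale (w22_cocycle 2 (- 2)) (rep w22_C2 1) = 0"
    using relation_L_W[of 2 "- 2"] by (simp only: add_cancel_right_right)
  then have "rep w22_C2 1 = 0"
    by (simp add: w22_cocycle_def)
  then show ?thesis
    using rep_C[of w22_C2 f] by simp
qed

definition F where "F lam n = smult (lam powi (- n)) (coeff (b n) 0)"

lemma relation_L_L:
  assumes A: "\<And>n. A n = smult (lam powi n) [:- (of_int n * \<alpha>), 1:]" and "lam \<noteq> 0"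
  shows "poly2_scale (lam powi (m + n)) [:smult (of_int n) (F lam n) - smult (of_int m) (F lam m)
     - smult (of_int m) (pderiv (F lam n) * [:- (of_int m * \<alpha>), 1:])
     + smult (of_int n) (pderiv (F lam m) * [:- (of_int n * \<alpha>), 1:])
     - smult (of_int (n - m)) (F lam (m + n)):] = poly2_scale (w22_cocycle m n) (rep w22_C1 1)"
proof -
  have b: "b n = poly2_scale (lam powi n) [:F lam n, 1:]" for n
    using b_normal_form[OF assms, of n] \<open>lam \<noteq> 0\<close>
    by (simp add: poly2_scale_const F_def power_int_minus one_pCons)
  have a: "a n = poly2_scale (lam powi n) [:[:- (of_int n * \<alpha>), 1:]:]" for n
    by (simp add: a_const A poly2_scale_const)
  have Lb: "rep (w22_L m) (b n) = poly2_scale (lam powi (m + n)) ([:F lam n - of_int m, 1:] * [:F lam m, 1:]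
      - poly2_scale (of_int m) [:pderiv (F lam n) * [:- (of_int m * \<alpha>), 1:]:])" for m n
  proof -
    have "pderiv (of_int m :: complex poly) = 0" by (simp add: of_int_poly)
    then have "deriv_t [:F lam n - of_int m, 1:] * [:[:- (of_int m * \<alpha>), 1:]:] =
        [:pderiv (F lam n) * [:- (of_int m * \<alpha>), 1:]:]"
      by (simp add: pderiv_diff)
    then show ?thesis
      using \<open>lam \<noteq> 0\<close> unfolding rep_L b[of n] b[of m] a[of m]
      by (simp add: poly2_scale_mult scale_right_diff_distrib power_int_add mult_ac
        del: mult_pCons_left mult_pCons_right)
  qed
  have rel: "poly2_scale (lam powi (m + n)) (([:F lam n - of_int m, 1:] * [:F lam m, 1:]
      - poly2_scale (of_int m) [:pderiv (F lam n) * [:- (of_int m * \<alpha>), 1:]:])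
    - ([:F lam m - of_int n, 1:] * [:F lam n, 1:]
      - poly2_scale (of_int n) [:pderiv (F lam m) * [:- (of_int n * \<alpha>), 1:]:])
    - poly2_scale (of_int (n - m)) [:F lam (m + n), 1:]) = poly2_scale (w22_cocycle m n) (rep w22_C1 1)"
    using bracket_L_L[of m n 1] unfolding b_def[symmetric] Lb b[of "m + n"]
    by (simp add: scale_right_diff_distrib add.commute[of n m] mult.commute[of "of_int (n - m)"] algebra_simps
        del: mult_pCons_left mult_pCons_right)
  \<comment> \<open>The terms s^2 and F_m F_n cancel. The surviving (n - m) s is removed by the
    right-hand side (n - m) (s + F_{m+n}).\<close>
  have PQ: "[:F lam n - of_int m, 1:] * [:F lam m, 1:] - [:F lam m - of_int n, 1:] * [:F lam n, 1:]
     = [:smult (of_int n) (F lam n) - smult (of_int m) (F lam m), of_int (n - m):]"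
    by (simp add: algebra_simps of_int_poly)
  have "([:F lam n - of_int m, 1:] * [:F lam m, 1:]
      - poly2_scale (of_int m) [:pderiv (F lam n) * [:- (of_int m * \<alpha>), 1:]:])
    - ([:F lam m - of_int n, 1:] * [:F lam n, 1:]
      - poly2_scale (of_int n) [:pderiv (F lam m) * [:- (of_int n * \<alpha>), 1:]:])
    - poly2_scale (of_int (n - m)) [:F lam (m + n), 1:]
    = ([:F lam n - of_int m, 1:] * [:F lam m, 1:] - [:F lam m - of_int n, 1:] * [:F lam n, 1:])
      - poly2_scale (of_int m) [:pderiv (F lam n) * [:- (of_int m * \<alpha>), 1:]:]
      + poly2_scale (of_int n) [:pderiv (F lam m) * [:- (of_int n * \<alpha>), 1:]:]
      - poly2_scale (of_int (n - m)) [:F lam (m + n), 1:]"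
    by (simp only: algebra_simps)
  also have "\<dots> = [:smult (of_int n) (F lam n) - smult (of_int m) (F lam m)
     - smult (of_int m) (pderiv (F lam n) * [:- (of_int m * \<alpha>), 1:])
     + smult (of_int n) (pderiv (F lam m) * [:- (of_int n * \<alpha>), 1:])
     - smult (of_int (n - m)) (F lam (m + n)):]"
    unfolding PQ by (simp add: poly2_scale_const of_int_poly)
  finally show ?thesis
    using rel by simp
qed

lemma F_normal_form:
  assumes A: "\<And>n. A n = smult (lam powi n) [:- (of_int n * \<alpha>), 1:]" and "lam \<noteq> 0"
  shows "F lam \<in> H_family \<alpha>" "rep w22_C1 1 = 0"
proof -
  obtain h \<kappa> G where h: "h \<in> H_family \<alpha>" "h 1 = F lam 1"
    and hG: "\<And>n. h n = smult (of_int n) ([:\<kappa>:] + [:- (of_int n * \<alpha>), 1:] * G)"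
    using H_family_normal_form[of \<alpha> "F lam 1"] by metis
  let ?R = "\<lambda>F m n. smult (of_int n) (F n) - smult (of_int m) (F m)
     - smult (of_int m) (pderiv (F n) * [:- (of_int m * \<alpha>), 1:])
     + smult (of_int n) (pderiv (F m) * [:- (of_int n * \<alpha>), 1:])
     - smult (of_int (n - m)) (F (m + n)) :: complex poly"
  have Rh: "?R h m n = 0" for m n
    using L_relation_normal_form[of n \<kappa> \<alpha> G m] by (simp only: hG) simp
  \<comment> \<open>For m = 1 and m = -1 the cocycle vanishes, so these relations hold whatever C_1
    does.\<close>
  have RF: "?R (F lam) m n = 0" if "m = 1 \<or> m = - 1" for m n
    using relation_L_L[OF assms, of m n] that \<open>lam \<noteq> 0\<close> by (auto simp: poly2_scale_const)
  have L_rec: "L_rec \<alpha> H" "L_rec (- \<alpha>) (\<lambda>n. H (- n))"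
    if R: "\<And>m n. m = 1 \<or> m = - 1 \<Longrightarrow> ?R H m n = 0" for H
  proof -
    show "L_rec \<alpha> H"
      unfolding L_rec_def using R[of 1] by (simp add: add.commute)
    show "L_rec (- \<alpha>) (\<lambda>n. H (- n))"
      unfolding L_rec_def
    proof (safe intro!: poly_ext)
      fix n x
      show "poly (smult (of_int n) (H (- n)) - H (- 1) - pderiv (H (- n)) * [:- (- \<alpha>), 1:]
         + smult (of_int n) (pderiv (H (- 1)) * [:- (of_int n * - \<alpha>), 1:])) x =
         poly (smult (of_int (n - 1)) (H (- (n + 1)))) x"
        using arg_cong[OF R[of "- 1" "- n"], of "\<lambda>p. poly p x"] by (simp add: algebra_simps)
    qed
  qed
  have "F lam n - h n = 0" for n
  proof (rule L_rec_zero)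
    show "L_rec \<alpha> (\<lambda>n. F lam n - h n)" "L_rec (- \<alpha>) (\<lambda>n. F lam (- n) - h (- n))"
      using L_rec[of "F lam"] L_rec[of h] RF Rh by (auto intro!: L_rec_diff)
    show "F lam 0 - h 0 = 0" by (simp add: F_def b_0 hG)
    show "F lam 1 - h 1 = 0" by (simp add: h)
  qed
  then have "F lam = h" by auto
  with h show "F lam \<in> H_family \<alpha>" by simp
  \<comment> \<open>Now that F is known, the left-hand side of \<open>relation_L_L\<close> vanishes
    for all m and n; the pair (2, -2), with cocycle 1/2, isolates C_1.\<close>
  have "poly2_scale (w22_cocycle 2 (- 2)) (rep w22_C1 1) = 0"
    using relation_L_L[OF assms, of 2 "- 2"] unfolding \<open>F lam = h\<close> Rh
    by (simp add: poly2_scale_const)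
  then show "rep w22_C1 1 = 0"
    by (simp add: w22_cocycle_def)
qed

lemma rep_coords: "rep x f = lin_ext poly2_scale (\<lambda>k. rep (w22_of_coords (Poly_Mapping.single k 1)) f) (w22_coords x)"
proof -
  have "rep (w22_of_coords p) f = lin_ext poly2_scale (\<lambda>k. rep (w22_of_coords (Poly_Mapping.single k 1)) f) p" for p
  proof (induction p rule: pm_induct)
    case (add p q)
    have "w22_of_coords (p + q) = w22_of_coords p + w22_of_coords q"
      by (simp flip: w22_coords_inject add: w22_coords_simps w22_of_coords_inverse)
    with add show ?case by (simp add: rep_add lin_ext_add poly2_scale_vector_space)
  next
    case (scale c p)
    have "w22_of_coords (pm_scale c p) = c *\<^sub>C w22_of_coords p"
      by (simp flip: w22_coords_inject add: w22_coords_simps w22_of_coords_inverse)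
    with scale show ?case by (simp add: rep_scaleL lin_ext_scale poly2_scale_vector_space)
  qed (simp add: poly2_scale_vector_space)
  from this[of "w22_coords x"] show ?thesis by (simp add: w22_coords_inverse)
qed

lemma rep_eq_omega_act:
  obtains lam \<alpha> h where "lam \<noteq> 0" "h \<in> H_family \<alpha>" "rep = omega_act lam \<alpha> h"
proof -
  obtain lam \<alpha> where lam: "lam \<noteq> 0" and A: "\<And>n. A n = smult (lam powi n) [:- (of_int n * \<alpha>), 1:]"
    using W_rec_solution[OF W_rec_A] a_0 by (auto simp: A_def)
  note A_lam = A lam
  have basis: "rep (w22_of_coords (Poly_Mapping.single k 1)) f = omega_basis_act lam \<alpha> (F lam) k f" for k f
  proof (cases k)
    case (BL m)
    have b: "b m = poly2_scale (lam powi m) [:F lam m, 1:]"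
      using b_normal_form[OF A_lam, of m] lam by (simp add: poly2_scale_const F_def power_int_minus one_pCons)
    have "a m = poly2_scale (lam powi m) [:[:- (of_int m * \<alpha>), 1:]:]"
      by (simp add: a_const A poly2_scale_const)
    with b show ?thesis
      by (simp add: BL rep_L poly2_scale_mult mult_ac flip: w22_L_def del: mult_pCons_left mult_pCons_right)
  next
    case (BW m)
    have "a m = poly2_scale (lam powi m) [:[:- (of_int m * \<alpha>), 1:]:]"
      by (simp add: a_const A poly2_scale_const)
    then show ?thesis
      by (simp add: BW rep_W poly2_scale_mult mult.commute flip: w22_W_def del: mult_pCons_left mult_pCons_right)
  next
    case BC1
    then show ?thesis
      using rep_C[of w22_C1 f] F_normal_form(2)[OF A_lam] by (simp flip: w22_C1_def)
  next
    case BC2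
    then show ?thesis
      using rep_C2_zero[OF A_lam] by (simp flip: w22_C2_def)
  qed
  show thesis
  proof (rule that[OF lam F_normal_form(1)[OF A_lam]])
    show "rep = omega_act lam \<alpha> (F lam)"
      by (intro ext) (subst rep_coords, simp only: omega_act_def basis)
  qed
qed

end

section \<open>The enveloping algebra of the Cartan subalgebra\<close>

lemma uea_of_zero: "uea_of 0 = 0" and uea_const_zero: "uea_const 0 = 0"
  using uea_of_add[of 0 0] uea_const_add[of 0 0] by simp_all

lemma uea_induct [case_names one const add letter]:
  fixes u :: "'g::complex_lie_algebra uea"
  assumes one: "P 1"
    and const: "\<And>c u. P u \<Longrightarrow> P (uea_const c * u)"
    and add: "\<And>u v. P u \<Longrightarrow> P v \<Longrightarrow> P (u + v)"
    and letter: "\<And>x u. P u \<Longrightarrow> P (uea_of x * u)"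
  shows "P u"
proof -
  have word: "P (abs_uea (Poly_Mapping.single (Word xs) 1))" for xs
  proof (induction xs)
    case Nil
    have "abs_uea (Poly_Mapping.single (Word []) 1) = (1 :: 'g uea)"
      by (simp only: one_uea_def zero_word_def[symmetric] single_one)
    then show ?case using one by simp
  next
    case (Cons x xs)
    have "Poly_Mapping.single (Word (x # xs)) 1 = free_letter x * Poly_Mapping.single (Word xs) 1"
      by (simp add: free_letter_def mult_single)
    then show ?case
      using letter[OF Cons, of x] by (simp only: uea_of.abs_eq times_uea.abs_eq)
  qed
  have "P (abs_uea p)" for p
  proof (induction p rule: pm_induct)
    case (add p q)
    then show ?case using assms(3) by (simp flip: plus_uea.abs_eq)
  next
    case (scale c p)
    have "pm_scale c p = free_const c * p"
      by (simp add: free_const_def pm_scale_def mult_map_scale_conv_mult)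
    then show ?case
      using const[OF scale, of c] by (simp only: uea_const.abs_eq times_uea.abs_eq)
  next
    case (single w)
    show ?case using word by (cases w) simp
  qed
  then show ?thesis
    by (metis Quotient3_abs_rep[OF Quotient3_uea])
qed

definition cartan_L :: cartan22 where "cartan_L = cartan22_of (w22_L 0)"
definition cartan_W :: cartan22 where "cartan_W = cartan22_of (w22_W 0)"

lemma cartan22_incl_simps:
  "cartan22_incl cartan_L = w22_L 0" "cartan22_incl cartan_W = w22_W 0"
proof -
  have "w22_L 0 = 1 *\<^sub>C w22_L 0 + 0 *\<^sub>C w22_W 0" "w22_W 0 = 0 *\<^sub>C w22_L 0 + 1 *\<^sub>C w22_W 0"
    by (simp_all add: scaleL_one)
  then show "cartan22_incl cartan_L = w22_L 0" "cartan22_incl cartan_W = w22_W 0"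
    unfolding cartan_L_def cartan_W_def by (blast intro: cartan22_of_inverse)+
qed

lemma bracket_cartan22_zero: "bracket x y = (0 :: cartan22)"
proof -
  have "bracket (cartan22_incl x) (cartan22_incl y) = 0"
    using cartan22_incl[of x] cartan22_incl[of y] bracket_cartan22 by auto
  then show ?thesis
    by (simp flip: cartan22_incl_inject add: bracket_cartan22.rep_eq zero_cartan22.rep_eq)
qed

definition cartan_coord :: "w22_basis \<Rightarrow> cartan22 \<Rightarrow> complex" where
  "cartan_coord k x = Poly_Mapping.lookup (w22_coords (cartan22_incl x)) k"

lemma cartan_coord_linear:
  "cartan_coord k (x + y) = cartan_coord k x + cartan_coord k y"
  "cartan_coord k (c *\<^sub>C x) = c * cartan_coord k x"
  "cartan_coord k 0 = 0"
  by (simp_all add: cartan_coord_def plus_cartan22.rep_eq scaleL_cartan22.rep_eq zero_cartan22.rep_eq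
      w22_coords_simps lookup_add)

lemma cartan22_decompose:
  "x = cartan_coord (BL 0) x *\<^sub>C cartan_L + cartan_coord (BW 0) x *\<^sub>C cartan_W"
proof -
  obtain a b where x: "cartan22_incl x = a *\<^sub>C w22_L 0 + b *\<^sub>C w22_W 0"
    using cartan22_incl by blast
  then have "cartan_coord (BL 0) x = a" "cartan_coord (BW 0) x = b"
    by (simp_all add: cartan_coord_def w22_coords_simps lookup_add lookup_single)
  with x show ?thesis
    by (simp flip: cartan22_incl_inject add: plus_cartan22.rep_eq scaleL_cartan22.rep_eq cartan22_incl_simps)
qed

text \<open>The linear map with L_0 to s and W_0 to t. Its extensions to words, to the free algebra
  and to the quotient carry out the universal property of the enveloping algebra for the target
  \<complex>[t, s].\<close>

definition letter_poly :: "cartan22 \<Rightarrow> complex poly poly" where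
  "letter_poly x = poly2_scale (cartan_coord (BL 0) x) [:0, 1:] + poly2_scale (cartan_coord (BW 0) x) [:[:0, 1:]:]"

primrec word_poly :: "cartan22 word \<Rightarrow> complex poly poly" where
  "word_poly (Word xs) = prod_list (map letter_poly xs)"

definition free_poly :: "cartan22 free_alg \<Rightarrow> complex poly poly" where
  "free_poly = lin_ext poly2_scale word_poly"

interpretation poly2: vector_space poly2_scale
  by (rule poly2_scale_vector_space)

lemma free_poly_linear:
  "free_poly (p + q) = free_poly p + free_poly q" "free_poly (pm_scale c p) = poly2_scale c (free_poly p)"
  "free_poly (p - q) = free_poly p - free_poly q"
proof -
  show add: "free_poly (p + q) = free_poly p + free_poly q" for p q
    by (simp add: free_poly_def lin_ext_add poly2_scale_vector_space)
  show "free_poly (pm_scale c p) = poly2_scale c (free_poly p)"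
    by (simp add: free_poly_def lin_ext_scale poly2_scale_vector_space)
  show "free_poly (p - q) = free_poly p - free_poly q"
    using add[of "p - q" q] by simp
qed

lemma free_poly_single: "free_poly (Poly_Mapping.single w c) = poly2_scale c (word_poly w)"
  by (simp add: free_poly_def poly2_scale_vector_space)

lemma free_poly_mult: "free_poly (p * q) = free_poly p * free_poly q"
proof (induction p rule: pm_induct)
  case (single u)
  show ?case
  proof (induction q rule: pm_induct)
    case (single v)
    show ?case by (cases u; cases v) (simp add: mult_single free_poly_single)
  qed (simp_all add: distrib_left mult_pm_scale free_poly_linear poly2_scale_mult)
qed (simp_all add: distrib_right pm_scale_mult free_poly_linear poly2_scale_mult)

lemma free_poly_letter: "free_poly (free_letter x) = letter_poly x"
  by (simp add: free_letter_def free_poly_single)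

lemma free_poly_const: "free_poly (free_const c) = poly2_scale c 1"
  by (simp add: free_const_def free_poly_single zero_word_def)

lemma letter_poly_linear:
  "letter_poly (x + y) = letter_poly x + letter_poly y" "letter_poly (c *\<^sub>C x) = poly2_scale c (letter_poly x)"
  "letter_poly 0 = 0"
  by (simp_all add: letter_poly_def cartan_coord_linear poly2.scale_left_distrib poly2.scale_right_distrib algebra_simps)

text \<open>The bracket relations go to 0 because the subalgebra is abelian and \<complex>[t, s] is
  commutative.\<close>

lemma free_poly_ideal: "p \<in> uea_ideal \<Longrightarrow> free_poly p = 0"
proof (induction rule: uea_ideal.induct)
  case zero
  show ?case using free_poly_linear(2)[of 0 0] by simp
qed (simp_all add: free_poly_linear free_poly_mult free_poly_letter free_poly_const letter_poly_linear
      bracket_cartan22_zero poly2_scale_mult)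

lift_definition uea_poly :: "cartan22 uea \<Rightarrow> complex poly poly" is free_poly
  unfolding uea_cong_def using free_poly_ideal free_poly_linear(3) by (metis eq_iff_diff_eq_0)

lemma uea_poly_simps:
  "uea_poly (u + v) = uea_poly u + uea_poly v" "uea_poly (u * v) = uea_poly u * uea_poly v"
  "uea_poly (uea_const c) = poly2_scale c 1" "uea_poly 1 = 1" "uea_poly (uea_of x) = letter_poly x"
proof -
  show "uea_poly (u + v) = uea_poly u + uea_poly v" by transfer (rule free_poly_linear)
  show "uea_poly (u * v) = uea_poly u * uea_poly v" by transfer (rule free_poly_mult)
  show c: "uea_poly (uea_const c) = poly2_scale c 1" for c by transfer (rule free_poly_const)
  show "uea_poly 1 = 1" using c[of 1] by (simp add: uea_const_one)
  show "uea_poly (uea_of x) = letter_poly x" by transfer (rule free_poly_letter)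
qed

text \<open>Horner evaluation at W_0; \<open>poly_uea\<close> repeats it at L_0 with these values as
  coefficients.\<close>

definition poly1_uea :: "complex poly \<Rightarrow> cartan22 uea" where
  "poly1_uea p = fold_coeffs (\<lambda>c u. uea_const c + uea_of cartan_W * u) p 0"

definition poly_uea :: "complex poly poly \<Rightarrow> cartan22 uea" where
  "poly_uea f = fold_coeffs (\<lambda>p u. poly1_uea p + uea_of cartan_L * u) f 0"

text \<open>The exceptional case is \<open>pCons 0 0 = 0\<close>, where no coefficient is folded;
  there the assumption makes the extra step harmless.\<close>

lemma fold_coeffs_pCons_fixed_0:
  assumes "g 0 z = z"
  shows "fold_coeffs g (pCons a p) z = g a (fold_coeffs g p z)"
  using assms by (cases "a = 0 \<and> p = 0") (auto simp: fold_coeffs_def)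

lemma poly1_uea_pCons: "poly1_uea (pCons c p) = uea_const c + uea_of cartan_W * poly1_uea p"
  unfolding poly1_uea_def by (rule fold_coeffs_pCons_fixed_0) (simp add: uea_const_zero)

lemma poly1_uea_0 [simp]: "poly1_uea 0 = 0"
  by (simp add: poly1_uea_def)

lemma poly_uea_pCons: "poly_uea (pCons p f) = poly1_uea p + uea_of cartan_L * poly_uea f"
  unfolding poly_uea_def by (rule fold_coeffs_pCons_fixed_0) simp

lemma poly_uea_0 [simp]: "poly_uea 0 = 0"
  by (simp add: poly_uea_def)

lemma poly1_uea_linear:
  "poly1_uea (p + q) = poly1_uea p + poly1_uea q" "poly1_uea (smult c p) = uea_const c * poly1_uea p"
proof -
  show "poly1_uea (p + q) = poly1_uea p + poly1_uea q"
    by (induction p q rule: poly_induct2) (simp_all add: poly1_uea_pCons uea_const_add distrib_left add_ac)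
  show "poly1_uea (smult c p) = uea_const c * poly1_uea p"
    by (induction p) (simp_all add: poly1_uea_pCons uea_const_mult distrib_left mult.assoc[symmetric]
        uea_const_commute[of c "uea_of cartan_W"])
qed

lemma uea_cartan_commute: "uea_of cartan_W * uea_of cartan_L = uea_of cartan_L * uea_of cartan_W"
  using uea_of_bracket[of cartan_W cartan_L] by (simp add: bracket_cartan22_zero uea_of_zero)

lemma poly_uea_simps:
  "poly_uea (f + g) = poly_uea f + poly_uea g" "poly_uea (poly2_scale c f) = uea_const c * poly_uea f"
  "poly_uea ([:0, 1:] * f) = uea_of cartan_L * poly_uea f"
  "poly_uea ([:[:0, 1:]:] * f) = uea_of cartan_W * poly_uea f"
  "poly_uea 1 = 1"
proof -
  show "poly_uea (f + g) = poly_uea f + poly_uea g"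
    by (induction f g rule: poly_induct2) (simp_all add: poly_uea_pCons poly1_uea_linear distrib_left add_ac)
  show "poly_uea (poly2_scale c f) = uea_const c * poly_uea f"
    by (induction f) (simp_all add: poly2_scale_def poly_uea_pCons poly1_uea_linear distrib_left mult.assoc[symmetric]
        uea_const_commute[of c "uea_of cartan_L"])
  show "poly_uea ([:0, 1:] * f) = uea_of cartan_L * poly_uea f"
    by (simp add: poly_uea_pCons)
  show "poly_uea ([:[:0, 1:]:] * f) = uea_of cartan_W * poly_uea f"
    by (induction f) (simp_all add: poly_uea_pCons poly1_uea_pCons uea_const_zero distrib_left uea_cartan_commute
        flip: mult.assoc)
  show "poly_uea 1 = 1"
    by (simp add: one_pCons poly_uea_pCons poly1_uea_pCons uea_const_one)
qed

text \<open>\<open>poly_uea\<close> turns multiplication by s and t into left multiplication by L_0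
  and W_0, and every letter is a combination of these two.\<close>

lemma poly_uea_uea_poly: "poly_uea (uea_poly u) = u"
proof (induction u rule: uea_induct)
  case (letter x u)
  have "letter_poly x * uea_poly u = poly2_scale (cartan_coord (BL 0) x) ([:0, 1:] * uea_poly u)
      + poly2_scale (cartan_coord (BW 0) x) ([:[:0, 1:]:] * uea_poly u)"
    unfolding letter_poly_def by (simp only: distrib_right poly2_scale_mult)
  then have "poly_uea (uea_poly (uea_of x * u)) =
      (uea_const (cartan_coord (BL 0) x) * uea_of cartan_L + uea_const (cartan_coord (BW 0) x) * uea_of cartan_W) * u"
    by (simp only: uea_poly_simps poly_uea_simps letter distrib_right mult.assoc)
  also have "\<dots> = uea_of x * u"
    by (subst (3) cartan22_decompose) (simp only: uea_of_add uea_of_scaleL)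
  finally show ?case .
qed (simp_all add: uea_poly_simps poly_uea_simps poly2_scale_mult)

lemma letter_poly_basis: "letter_poly cartan_L = [:0, 1:]" "letter_poly cartan_W = [:[:0, 1:]:]"
  by (simp_all add: letter_poly_def cartan_coord_def cartan22_incl_simps w22_coords_simps lookup_single)

lemma uea_poly_poly_uea: "uea_poly (poly_uea f) = f"
  by (induction f rule: poly2_induct)
    (simp_all add: poly_uea_simps uea_poly_simps poly2_scale_mult letter_poly_basis
      del: mult_pCons_left)

lemma bij_poly_uea: "bij poly_uea"
  by (rule bij_betw_byWitness[of _ uea_poly]) (simp_all add: poly_uea_uea_poly uea_poly_poly_uea)

section \<open>Free modules of rank 1\<close>

text \<open>A coefficient function supported in \<open>{e}\<close> amounts to one scalar: existence
  of expansions gives surjectivity, uniqueness gives injectivity.\<close>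

lemma free_of_rank_1_generator:
  assumes "free_of_rank act 1"
  obtains e where "bij (\<lambda>u. act u e)"
proof -
  interpret left_module act using assms by (simp add: free_of_rank_def)
  have act_0: "act 0 x = 0" for x using act_add_left[of 0 0 x] by simp
  obtain e where e: "module_basis act {e}"
    using assms unfolding free_of_rank_def by (auto simp: card_1_singleton_iff)
  let ?rep = "\<lambda>x c. finite {b. c b \<noteq> 0} \<and> {b. c b \<noteq> 0} \<subseteq> {e} \<and> x = (\<Sum>b | c b \<noteq> 0. act (c b) b)"
  have uniq: "\<exists>!c. ?rep x c" for x
    using e unfolding module_basis_def by blast
  have val: "x = act (c e) e" if "?rep x c" for x c
  proof -
    \<comment> \<open>For \<open>c e = 0\<close> the support is empty, and the empty sum still
      equals \<open>act (c e) e\<close>.\<close>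
    have "{b. c b \<noteq> 0} = {} \<or> {b. c b \<noteq> 0} = {e}" using that by blast
    then show ?thesis using that act_0 by (auto simp: subset_singleton_iff)
  qed
  have rep: "?rep (act u e) (\<lambda>b. if b = e then u else 0)" for u
  proof (cases "u = 0")
    case False
    then have "{b. (if b = e then u else 0) \<noteq> 0} = {e}" by auto
    then show ?thesis by simp
  qed (simp add: act_0)
  have "inj (\<lambda>u. act u e)"
  proof (rule injI)
    fix u v
    assume eq: "act u e = act v e"
    obtain c where c: "\<And>c'. ?rep (act u e) c' \<Longrightarrow> c' = c"
      using uniq[of "act u e"] by (elim ex1E) blast
    have u: "(\<lambda>b. if b = e then u else 0) = c"
      by (rule c[OF rep])
    have v: "(\<lambda>b. if b = e then v else 0) = c"
      by (rule c) (unfold eq, rule rep)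
    show "u = v"
      using fun_cong[OF trans[OF u sym[OF v]], of e] by simp
  qed
  moreover have "surj (\<lambda>u. act u e)"
  proof (rule surjI)
    fix x
    show "act ((SOME c. ?rep x c) e) e = x"
      using val[OF someI_ex[OF ex1_implies_ex[OF uniq]], of x] by (rule sym)
  qed
  ultimately show thesis using that by (simp add: bij_def)
qed

section \<open>Classification\<close>

lemma lie_module_isomorphic_transport:
  assumes "lie_module scale1 rep" "Vector_Spaces.linear scale1 scale2 \<phi>" "bij \<phi>"
  shows "lie_module_isomorphic scale1 rep scale2 (\<lambda>x w. \<phi> (rep x (inv \<phi> w)))"
proof -
  interpret lie_module scale1 rep by fact
  interpret \<phi>: Vector_Spaces.linear scale1 scale2 \<phi> by fact
  have inv: "inv \<phi> (\<phi> v) = v" "\<phi> (inv \<phi> w) = w" for v w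
    using \<open>bij \<phi>\<close> by (simp_all add: bij_is_inj bij_is_surj surj_f_inv_f)
  have rep: "rep x (v + w) = rep x v + rep x w" "rep x (scale1 c v) = scale1 c (rep x v)" for x v w c
    using rep_linear[of x] by (auto simp: Vector_Spaces.linear_iff)
  have inv_lin: "inv \<phi> (v + w) = inv \<phi> v + inv \<phi> w" "inv \<phi> (scale2 c v) = scale1 c (inv \<phi> v)" for v w c
    by (metis inv \<phi>.add, metis inv \<phi>.scale)
  have "lie_module scale2 (\<lambda>x w. \<phi> (rep x (inv \<phi> w)))"
    by unfold_locales
      (simp_all add: inv inv_lin rep \<phi>.add \<phi>.scale \<phi>.diff rep_add rep_scaleL rep_bracket)
  then show ?thesis
    unfolding lie_module_isomorphic_def using assms inv by auto
qed

theorem theorem4: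
  fixes act :: "w22 uea \<Rightarrow> 'm::ab_group_add \<Rightarrow> 'm"
  assumes "left_module act"
    and "free_of_rank (\<lambda>u :: cartan22 uea. act (uea_map cartan22_incl u)) 1"
  shows "\<exists>lam \<alpha> h. lam \<noteq> 0 \<and> h \<in> H_family \<alpha> \<and>
    lie_module_isomorphic (\<lambda>c. act (uea_const c)) (\<lambda>x. act (uea_of x))
      poly2_scale (omega_act lam \<alpha> h)"
proof -
  interpret left_module act by fact
  interpret V: lie_module "\<lambda>c. act (uea_const c)" "\<lambda>x. act (uea_of x)"
    by (rule left_module_lie_module) fact
  obtain e where e: "bij (\<lambda>u. act (uea_map cartan22_incl u) e)"
    using free_of_rank_1_generator[OF assms(2)] by blast
  \<comment> \<open>The composite of \<complex>[t, s] with the enveloping algebra and with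
    evaluation at the generator \<open>e\<close>; it turns multiplication by s and t into L_0 and
    W_0.\<close>
  define \<psi> where "\<psi> f = act (uea_map cartan22_incl (poly_uea f)) e" for f
  note incl = uea_map_hom[OF lie_hom_cartan22_incl] cartan22_incl_simps
  have \<psi>: "\<psi> (f + g) = \<psi> f + \<psi> g" "\<psi> (poly2_scale c f) = act (uea_const c) (\<psi> f)"
    "\<psi> ([:0, 1:] * f) = act (uea_of (w22_L 0)) (\<psi> f)"
    "\<psi> ([:[:0, 1:]:] * f) = act (uea_of (w22_W 0)) (\<psi> f)" for f g c
    unfolding \<psi>_def poly_uea_simps by (simp_all only: incl act_add_left act_mult)
  have "bij \<psi>"
    using bij_comp[OF bij_poly_uea e] by (simp add: \<psi>_def[abs_def] comp_def)
  have "Vector_Spaces.linear poly2_scale (\<lambda>c. act (uea_const c)) \<psi>"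
    by unfold_locales (simp_all add: \<psi>)
  define \<phi> where "\<phi> = inv \<psi>"
  have inv: "\<phi> (\<psi> f) = f" "\<psi> (\<phi> v) = v" for f v
    using \<open>bij \<psi>\<close> by (simp_all add: \<phi>_def bij_is_inj bij_is_surj surj_f_inv_f)
  have "bij \<phi>" "inv \<phi> = \<psi>"
    using \<open>bij \<psi>\<close> by (simp_all add: \<phi>_def bij_imp_bij_inv inv_inv_eq)
  have lin: "Vector_Spaces.linear (\<lambda>c. act (uea_const c)) poly2_scale \<phi>"
    by unfold_locales (metis inv \<psi>(1), metis inv \<psi>(2))
  \<comment> \<open>The action transported to \<complex>[t, s], which satisfies the assumptions of
    \<open>cartan_free_module\<close>.\<close>
  let ?rep = "\<lambda>x f. \<phi> (act (uea_of x) (\<psi> f))"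
  have iso: "lie_module_isomorphic (\<lambda>c. act (uea_const c)) (\<lambda>x. act (uea_of x)) poly2_scale ?rep"
    using lie_module_isomorphic_transport[OF V.lie_module_axioms lin \<open>bij \<phi>\<close>] by (simp only: \<open>inv \<phi> = \<psi>\<close>)
  then interpret R: lie_module poly2_scale ?rep
    by (simp add: lie_module_isomorphic_def)
  interpret R: cartan_free_module ?rep
    by unfold_locales (simp_all only: \<psi>(3,4)[symmetric] inv)
  show ?thesis
    using R.rep_eq_omega_act iso by metis
qed

end
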